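(* For each $\varepsilon>0$ there exists $n_0=n_0(\varepsilon)$ such that the following holds for every $d\geq 10^{-5}$ and $n\geq n_0$. Let $D$ be an $n$-vertex $(d,\varepsilon)$-pseudorandom digraph containing a set $A$ with $|A|\geq n/\log^{[3]}n$ such that, with $m=n\log^{[3]}n/(d\log n)$: (i) for each $v\in V(D)$, $d^\pm(v,A)\geq d(\log n)^{3/4}$; (ii) for each $U\subset V(D)$ with $|U|=m$, $|N^\pm(U,A)|\geq (1/2+\varepsilon/2)|A|$. Then every set $V\subset V(D)\setminus A$ with \[|V|\leq \frac{|A|\log^{[2]}n}{\log n\cdot \log^{[7]}n}\] is strongly connected in $D[A\cup V]$.
   Context: $\log$ is natural and $\log^{[k]}n$ is the $k$-fold iterated logarithm of $n$. For a digraph $D$ and $U\subset V(D)$, $N^+(U)$ ($N^-(U)$) is the set of vertices outside $U$ with an in-neighbour (out-neighbour) in $U$; $N^\pm(U,A)=N^\pm(U)\cap A$; $d^\pm(v,A)$ is the number of out-/in-neighbours of $v$ in $A$; statements with $\pm$ hold for both $+$ and $-$. $D[W]$ is the induced subdigraph. An $n$-vertex digraph $D$ is $(d,\varepsilon)$-pseudorandom if, with $m=n\log^{[3]}n/(d\log n)$: (A1) $\delta^\pm(D)\geq d\log n$ and $\Delta^\pm(D)\leq 10^6 d\log n$; (A2) for each $j\in\{+,-\}$ and disjoint $A,B$ with $|A|\leq 2m$ and $d^j(v,B)\geq d\log^{[2]}n/\log^{[4]}n$ for all $v\in A$, $|B|\geq 10|A|$; (A3) for each $j\in\{+,-\}$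 and disjoint $A,B$ with $|A|\leq 2m$ and $d^j(v,B)\geq d(\log n)^{2/3}$ for all $v\in A$, $|B|\geq(\log n)^{1/3}|A|$; (A4) every $A$ with $|A|=m$ has $|N^\pm(A)|\geq(1/2+\varepsilon)n$. A vertex set $U$ in a digraph $D'$ is strongly connected in $D'$ if for any $\ell$ and any set $E=\{e_1,\ldots,e_\ell\}$ of pairwise vertex-disjoint directed edges with both endpoints in $U$ (edges of the complete digraph on $U$), there is a directed cycle in $D'+E$ containing $e_1,\ldots,e_\ell$ in that order. *)

theory Defs
  imports
    Complex_Main
    "HOL-Library.Sublist"
    "Graph_Theory.Pair_Digraph"
    "Graph_Theory.Digraph_Component"
begin

definition iter_log :: "nat \<Rightarrow> real \<Rightarrow> real" where
  "iter_log k x = (ln ^^ k) x"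

text \<open>The two signs: \<open>Plus\<close> refers to out-neighbours, \<open>Minus\<close> to in-neighbours.\<close>

datatype sign = Plus | Minus

fun nbrs :: "sign \<Rightarrow> 'a pair_pre_digraph \<Rightarrow> 'a \<Rightarrow> 'a set" where
  "nbrs Plus D v = {w. (v, w) \<in> parcs D}"
| "nbrs Minus D v = {w. (w, v) \<in> parcs D}"

definition deg_in_set :: "sign \<Rightarrow> 'a pair_pre_digraph \<Rightarrow> 'a \<Rightarrow> 'a set \<Rightarrow> nat" where
  "deg_in_set s D v A = card (nbrs s D v \<inter> A)"

definition ext_nbhd :: "sign \<Rightarrow> 'a pair_pre_digraph \<Rightarrow> 'a set \<Rightarrow> 'a set" where
  "ext_nbhd s D U = (\<Union>u\<in>U. nbrs s D u) - U"

text \<open>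
  The parameter \<open>m\<close> is a real number. Upper bounds \<open>card A \<le> 2 * m\<close> are taken literally;
  where a set has exactly \<open>m\<close> elements, \<open>m\<close> is rounded down to an integer.
\<close>

definition m_par :: "real \<Rightarrow> nat \<Rightarrow> real" where
  "m_par d n = real n * iter_log 3 (real n) / (d * ln (real n))"

definition m_size :: "real \<Rightarrow> nat \<Rightarrow> nat" where
  "m_size d n = nat \<lfloor>m_par d n\<rfloor>"

definition pseudorandom :: "real \<Rightarrow> real \<Rightarrow> 'a pair_pre_digraph \<Rightarrow> bool" where
  "pseudorandom d \<epsilon> D \<longleftrightarrow> (let n = card (pverts D); L = ln (real n); m = m_par d n in
     (\<forall>s. \<forall>v\<in>pverts D.
        d * L \<le> real (deg_in_set s D v (pverts D)) \<and>
        real (deg_in_set s D v (pverts D)) \<le> 10 ^ 6 * d * L) \<and>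
     (\<forall>s A B. A \<subseteq> pverts D \<and> B \<subseteq> pverts D \<and> A \<inter> B = {} \<and> real (card A) \<le> 2 * m \<and>
        (\<forall>v\<in>A. d * iter_log 2 (real n) / iter_log 4 (real n) \<le> real (deg_in_set s D v B)) \<longrightarrow>
        10 * card A \<le> card B) \<and>
     (\<forall>s A B. A \<subseteq> pverts D \<and> B \<subseteq> pverts D \<and> A \<inter> B = {} \<and> real (card A) \<le> 2 * m \<and>
        (\<forall>v\<in>A. d * L powr (2 / 3) \<le> real (deg_in_set s D v B)) \<longrightarrow>
        L powr (1 / 3) * real (card A) \<le> real (card B)) \<and>
     (\<forall>s A. A \<subseteq> pverts D \<and> card A = m_size d n \<longrightarrow>
        (1 / 2 + \<epsilon>) * real n \<le> real (card (ext_nbhd s D A))))"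

text \<open>
  The list \<open>es\<close> enumerates the edges \<open>e\<^sub>1, \<dots>, e\<^sub>l\<close> (arcs are pairs, so \<open>G\<close> is meant to be of the
  form \<open>with_proj D\<close> or an induced subdigraph of it). A cycle is a closed arc walk with a chosen
  starting point. As that point is arbitrary, containing \<open>e\<^sub>1, \<dots>, e\<^sub>l\<close> in this (cyclic)
  order means that for some starting point \<open>es\<close> is a subsequence of the list of arcs.
\<close>

definition strongly_connected_in :: "'a set \<Rightarrow> ('a, 'a \<times> 'a) pre_digraph \<Rightarrow> bool" where
  "strongly_connected_in U G \<longleftrightarrow> U \<subseteq> verts G \<and>
     (\<forall>es. distinct es \<and>
        (\<forall>(x, y)\<in>set es. x \<in> U \<and> y \<in> U \<and> x \<noteq> y) \<and>
        pairwise (\<lambda>e f. disjnt {fst e, snd e} {fst f, snd f}) (set es) \<longrightarrow>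
        (\<exists>p. pre_digraph.cycle (G\<lparr>arcs := arcs G \<union> set es\<rparr>) p \<and> subseq es p))"

end

theory Submission
  imports Defs "HOL-Real_Asymp.Real_Asymp"
begin

text \<open>
  The vertices \<open>y\<^sub>i\<close> and \<open>x\<^sub>i\<^sub>+\<^sub>1\<close> are joined one pair after the other by short paths through unused
  vertices of \<open>A\<close>. An out-tree from \<open>y\<^sub>i\<close> and an in-tree into \<open>x\<^sub>i\<^sub>+\<^sub>1\<close>, both of branching number
  \<open>K \<approx> (log n)\<^sup>1\<^sup>/\<^sup>3\<close> and depth \<open>O(log n / log log n)\<close>, reach \<open>m\<close> vertices each. The
  neighbourhoods of these two sets cover more than half of \<open>A\<close>, so they share many vertices, and
  one of these closes the path. All of the trees except the path is then released again.

  To avoid getting stuck, the Friedman--Pippenger method keeps a Hall-type invariant alive: in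
  the bipartite graph whose left side has an out-slot and an in-slot for every vertex and whose right
  side is \<open>A\<close>, every small set of slots still sees enough unused vertices to give each slot the
  rest of its \<open>K\<close> private neighbours. Sets of \<open>m\<close> or more slots have neighbours to spare,
  so tight sets are small and closed under union, which permits extension by one vertex; releasing
  any assigned vertices keeps the invariant.
\<close>

section \<open>The Hall-type invariant\<close>

text \<open>\<open>b\<close> bounds the number of vertices that may be used or blocked at one time.
  By \<open>large_expand\<close>, a set of between \<open>M\<close> and \<open>2 * M\<close> slots
  keeps more than \<open>K\<close> free neighbours per slot even after losing \<open>b\<close> of
  them, so among sets of at most \<open>2 * M\<close> slots the Hall condition can be critical only
  below \<open>M\<close>.\<close>

locale residual_expansion =
  fixes L :: "'l set" and N :: "'l \<Rightarrow> 'a set" and K M b :: nat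
  assumes finite_L: "finite L"
    and finite_N: "\<And>v. finite (N v)"
    and M_pos: "M \<ge> 1"
    and large_expand: "\<And>U. U \<subseteq> L \<Longrightarrow> M \<le> card U \<Longrightarrow> card U \<le> 2 * M \<Longrightarrow>
      K * card U + b < card (\<Union>(N ` U))"
begin

text \<open>
  A pair \<open>(v, w) \<in> F\<close> assigns the vertex \<open>w\<close> to the slot \<open>v\<close> and counts towards its \<open>K\<close>
  neighbours. Vertices in \<open>Z\<close> are unavailable without being credited to any slot.
\<close>

definition good :: "('l \<times> 'a) set \<Rightarrow> 'a set \<Rightarrow> bool" where
  "good F Z \<longleftrightarrow> finite F \<and> finite Z \<and> F \<subseteq> Sigma L N \<and> inj_on snd F \<and> snd ` F \<inter> Z = {} \<and>
     (\<forall>U\<subseteq>L. card U \<le> 2 * M \<longrightarrow>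
        K * card U \<le> card (\<Union>(N ` U) - (snd ` F \<union> Z)) + card (F \<inter> U \<times> UNIV))"

definition capacity :: "('l \<times> 'a) set \<Rightarrow> 'a set \<Rightarrow> 'l set \<Rightarrow> nat" where
  "capacity F Z U = card (\<Union>(N ` U) - (snd ` F \<union> Z)) + card (F \<inter> U \<times> UNIV)"

text \<open>The bound is \<open>M\<close> rather than \<open>2 * M\<close>, so that the union of two
  tight sets still has a size to which the condition in \<open>good\<close> applies.\<close>

definition tight :: "('l \<times> 'a) set \<Rightarrow> 'a set \<Rightarrow> 'l set \<Rightarrow> bool" where
  "tight F Z U \<longleftrightarrow> U \<subseteq> L \<and> card U \<le> M \<and> capacity F Z U = K * card U"

lemma goodD:
  assumes "good F Z"
  shows "finite F" "finite Z" "F \<subseteq> Sigma L N" "inj_on snd F" "snd ` F \<inter> Z = {}"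
    and "\<And>U. U \<subseteq> L \<Longrightarrow> card U \<le> 2 * M \<Longrightarrow> K * card U \<le> capacity F Z U"
  using assms by (auto simp: good_def capacity_def)

lemma finite_Union_N: "U \<subseteq> L \<Longrightarrow> finite (\<Union>(N ` U))"
  using finite_L finite_N by (auto intro: finite_subset)

text \<open>Releasing a pair \<open>(v, w)\<close> with \<open>v \<in> U\<close> costs
  \<open>U\<close> one credit, but \<open>w\<close> is a neighbour of \<open>U\<close> and becomes
  free again. Injectivity of \<open>snd\<close> keeps the returned vertices distinct, so no capacity
  drops.\<close>

lemma good_subset:
  assumes g: "good F Z" and sub: "F' \<subseteq> F"
  shows "good F' Z"
proof -
  have "K * card U \<le> capacity F' Z U" if U: "U \<subseteq> L" "card U \<le> 2 * M" for U
  proof -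
    let ?G = "(F - F') \<inter> U \<times> UNIV"
    have fin: "finite F" "finite F'" using goodD(1)[OF g] sub finite_subset by auto
    have inj: "inj_on snd F" by (rule goodD(4)[OF g])
    have "card (F \<inter> U \<times> UNIV) = card (F' \<inter> U \<times> UNIV) + card ?G"
      using sub fin by (subst card_Un_disjoint[symmetric]) (auto intro: arg_cong[where f=card])
    moreover have "card ?G = card (snd ` ?G)"
      by (metis card_image inf_le1 inj Diff_subset inj_on_subset)
    moreover have "card (\<Union>(N ` U) - (snd ` F \<union> Z)) + card (snd ` ?G)
        = card ((\<Union>(N ` U) - (snd ` F \<union> Z)) \<union> snd ` ?G)"
      using fin finite_Union_N[OF U(1)] by (subst card_Un_disjoint) auto
    moreover have "card ((\<Union>(N ` U) - (snd ` F \<union> Z)) \<union> snd ` ?G)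
        \<le> card (\<Union>(N ` U) - (snd ` F' \<union> Z))"
    proof (rule card_mono)
      show "finite (\<Union>(N ` U) - (snd ` F' \<union> Z))" using finite_Union_N[OF U(1)] by auto
      have "w \<in> \<Union>(N ` U) - (snd ` F' \<union> Z)" if w: "(v, w) \<in> F" "(v, w) \<notin> F'" "v \<in> U" for v w
      proof -
        have "w \<in> N v" using goodD(3)[OF g] w by auto
        moreover have "w \<notin> Z" using goodD(5)[OF g] w by force
        moreover have "w \<notin> snd ` F'"
          using inj w sub by (auto simp: inj_on_def) force
        ultimately show ?thesis using w by auto
      qed
      then show "(\<Union>(N ` U) - (snd ` F \<union> Z)) \<union> snd ` ?G \<subseteq> \<Union>(N ` U) - (snd ` F' \<union> Z)"
        using sub by (force simp del: UN_iff)
    qed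
    ultimately have "capacity F Z U \<le> capacity F' Z U" unfolding capacity_def by linarith
    then show ?thesis using goodD(6)[OF g U] by linarith
  qed
  moreover have "finite F'" "finite Z" "F' \<subseteq> Sigma L N" "inj_on snd F'"
    using goodD[OF g] sub by (auto intro: finite_subset inj_on_subset)
  moreover have "snd ` F' \<inter> Z = {}" using goodD(5)[OF g] image_mono[OF sub, of snd] by blast
  ultimately show ?thesis unfolding good_def capacity_def by blast
qed

section \<open>Submodularity and tight sets\<close>

lemma capacity_submodular:
  assumes "finite F" "U \<subseteq> L" "W \<subseteq> L"
  shows "capacity F Z (U \<union> W) + capacity F Z (U \<inter> W) \<le> capacity F Z U + capacity F Z W"
proof -
  let ?S = "snd ` F \<union> Z"
  let ?P = "\<lambda>U. \<Union>(N ` U) - ?S" and ?Q = "\<lambda>U. F \<inter> U \<times> UNIV"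
  have fin: "finite (?P U)" "finite (?P W)" using finite_Union_N assms by auto
  \<comment> \<open>A common free neighbour of \<open>U\<close> and \<open>W\<close> need not be a
    neighbour of \<open>U \<inter> W\<close>, so this part is only submodular; the credits below are
    modular.\<close>
  have "card (?P (U \<union> W)) + card (?P (U \<inter> W)) \<le> card (?P U \<union> ?P W) + card (?P U \<inter> ?P W)"
    using fin by (intro add_mono card_mono) auto
  also have "\<dots> = card (?P U) + card (?P W)" using card_Un_Int[OF fin] by simp
  finally have 1: "card (?P (U \<union> W)) + card (?P (U \<inter> W)) \<le> card (?P U) + card (?P W)" .
  have "?Q U \<union> ?Q W = ?Q (U \<union> W)" "?Q U \<inter> ?Q W = ?Q (U \<inter> W)" by auto
  then have "card (?Q (U \<union> W)) + card (?Q (U \<inter> W)) = card (?Q U) + card (?Q W)"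
    using card_Un_Int[of "?Q U" "?Q W"] assms(1) by simp
  with 1 show ?thesis unfolding capacity_def by linarith
qed

text \<open>Above \<open>M\<close> slots, \<open>large_expand\<close> leaves positive slack even
  after the at most \<open>b\<close> used or blocked vertices are removed.\<close>

lemma capacity_eq_imp_small:
  assumes g: "good F Z" and b: "card F + card Z \<le> b"
    and U: "U \<subseteq> L" "card U \<le> 2 * M" "capacity F Z U \<le> K * card U"
  shows "tight F Z U"
proof -
  have "card U \<le> M"
  proof (rule ccontr)
    assume "\<not> card U \<le> M"
    then have "K * card U + b < card (\<Union>(N ` U))" using U by (intro large_expand) auto
    moreover have "card (snd ` F \<union> Z) \<le> b"
      using b card_Un_le[of "snd ` F" Z] card_image_le[OF goodD(1)[OF g], of snd] by linarith
    moreover have "card (\<Union>(N ` U)) - card (snd ` F \<union> Z) \<le> card (\<Union>(N ` U) - (snd ` F \<union> Z))"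
      using goodD(1,2)[OF g] by (intro diff_card_le_card_Diff) auto
    ultimately show False using U(3) unfolding capacity_def by linarith
  qed
  then show ?thesis using U goodD(6)[OF g U(1,2)] unfolding tight_def by auto
qed

text \<open>Uncrossing: the union has at most \<open>2 * M\<close> slots and the intersection
  satisfies the Hall condition, so submodularity leaves the union without slack. Then
  \<open>capacity_eq_imp_small\<close> brings its size back to at most \<open>M\<close>, and the
  induction can go on.\<close>

lemma tight_Union:
  assumes g: "good F Z" and b: "card F + card Z \<le> b"
    and fin: "finite \<U>" and t: "\<And>U. U \<in> \<U> \<Longrightarrow> tight F Z U"
  shows "tight F Z (\<Union>\<U>)"
  using fin t
proof (induction \<U> rule: finite_induct)
  case empty
  show ?case by (simp add: tight_def capacity_def)
next
  case (insert U \<U>)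
  define W where "W = \<Union>\<U>"
  have tU: "tight F Z U" and tW: "tight F Z W" using insert by (auto simp: W_def)
  have sub: "U \<subseteq> L" "W \<subseteq> L" using tU tW by (auto simp: tight_def)
  have fin: "finite U" "finite W" using sub finite_L finite_subset by auto
  have cd: "card (U \<union> W) + card (U \<inter> W) = card U + card W"
    using card_Un_Int[OF fin] by simp
  have le: "card (U \<union> W) \<le> 2 * M" using cd tU tW by (auto simp: tight_def)
  have "K * card (U \<inter> W) \<le> capacity F Z (U \<inter> W)"
    using sub cd tU tW by (intro goodD(6)[OF g]) (auto simp: tight_def)
  moreover have "K * card (U \<union> W) + K * card (U \<inter> W) = K * card U + K * card W"
    using cd by (metis distrib_left)
  ultimately have "capacity F Z (U \<union> W) \<le> K * card (U \<union> W)"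
    using capacity_submodular[OF goodD(1)[OF g] sub, of Z] tU tW unfolding tight_def by linarith
  then have "tight F Z (U \<union> W)" using capacity_eq_imp_small[OF g b _ le] sub by auto
  then show ?case by (simp add: W_def)
qed

text \<open>Merges the obstructions met by single vertices into one tight set that sees all
  candidates at once.\<close>

lemma tight_cover:
  assumes g: "good F Z" and b: "card F + card Z \<le> b" and fin: "finite W"
    and w: "\<And>w. w \<in> W \<Longrightarrow> \<exists>U. tight F Z U \<and> w \<in> \<Union>(N ` U) \<and> P \<inter> U = {}"
  obtains U where "tight F Z U" "W \<subseteq> \<Union>(N ` U)" "P \<inter> U = {}"
proof -
  obtain f where f: "\<And>w. w \<in> W \<Longrightarrow> tight F Z (f w) \<and> w \<in> \<Union>(N ` f w) \<and> P \<inter> f w = {}"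
    using w by metis
  have "tight F Z (\<Union>(f ` W))" using f fin by (intro tight_Union[OF g b]) auto
  moreover have "W \<subseteq> \<Union>(N ` \<Union>(f ` W))" "P \<inter> \<Union>(f ` W) = {}" using f by blast+
  ultimately show thesis by (rule that)
qed

text \<open>If every \<open>w \<in> C\<close> were obstructed, all of \<open>C\<close> would lie
  among the free neighbours of a single tight set, which has at most \<open>K * M\<close> of
  them.\<close>

lemma good_block:
  assumes g: "good F Z" and b: "card F + card Z \<le> b"
    and C: "finite C" "C \<inter> (snd ` F \<union> Z) = {}" "card C > K * M"
  shows "\<exists>w\<in>C. good F (insert w Z)"
proof (rule ccontr)
  assume "\<not> ?thesis"
  then have ng: "\<not> good F (insert w Z)" if "w \<in> C" for w using that by blast
  have "\<exists>U. tight F Z U \<and> w \<in> \<Union>(N ` U) \<and> {} \<inter> U = {}" if w: "w \<in> C" for w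
  proof -
    obtain U where U: "U \<subseteq> L" "card U \<le> 2 * M"
      "card (\<Union>(N ` U) - (snd ` F \<union> insert w Z)) + card (F \<inter> U \<times> UNIV) < K * card U"
      using ng[OF w] goodD[OF g] C(2) w unfolding good_def by auto
    have eq: "\<Union>(N ` U) - (snd ` F \<union> insert w Z) = (\<Union>(N ` U) - (snd ` F \<union> Z)) - {w}" by auto
    have le: "K * card U \<le> capacity F Z U" by (rule goodD(6)[OF g U(1,2)])
    have wN: "w \<in> \<Union>(N ` U)"
    proof (rule ccontr)
      assume "w \<notin> \<Union>(N ` U)"
      then have "\<Union>(N ` U) - (snd ` F \<union> Z) - {w} = \<Union>(N ` U) - (snd ` F \<union> Z)" by blast
      then show False using U(3) le unfolding eq capacity_def by simp
    qed
    have "capacity F Z U \<le> K * card U"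
      using U(3) card_Diff1_le[of "\<Union>(N ` U) - (snd ` F \<union> Z)" w]
        card_Diff_singleton_if[of "\<Union>(N ` U) - (snd ` F \<union> Z)" w]
      unfolding eq capacity_def by (auto split: if_splits)
    then show ?thesis using capacity_eq_imp_small[OF g b U(1,2)] wN by auto
  qed
  then obtain U where U: "tight F Z U" "C \<subseteq> \<Union>(N ` U)"
    using tight_cover[OF g b C(1), of "{}"] by metis
  have "card C \<le> card (\<Union>(N ` U) - (snd ` F \<union> Z))"
    using U C(2) finite_Union_N[of U] by (intro card_mono) (auto simp: tight_def)
  also have "\<dots> \<le> K * card U" using U(1) unfolding tight_def capacity_def by linarith
  also have "\<dots> \<le> K * M" using U(1) unfolding tight_def by simp
  finally show False using C(3) by simp
qed

text \<open>The Friedman-Pippenger extension step. If every free neighbour of \<open>v\<close> were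
  obstructed, one tight set \<open>U\<close> without \<open>v\<close> would see them all. Adding
  \<open>v\<close> to \<open>U\<close> would then bring no free neighbour and fewer than
  \<open>K\<close> credits, against the Hall condition.\<close>

lemma good_extend:
  assumes g: "good F Z" and b: "card F + card Z \<le> b"
    and v: "v \<in> L" "card (F \<inter> {v} \<times> UNIV) < K"
  shows "\<exists>w \<in> N v - (snd ` F \<union> Z). good (insert (v, w) F) Z"
proof (rule ccontr)
  assume "\<not> ?thesis"
  then have ng: "\<not> good (insert (v, w) F) Z" if "w \<in> N v - (snd ` F \<union> Z)" for w
    using that by blast
  let ?S = "snd ` F \<union> Z"
  have "\<exists>U. tight F Z U \<and> w \<in> \<Union>(N ` U) \<and> {v} \<inter> U = {}" if w: "w \<in> N v - ?S" for w
  proof -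
    have "inj_on snd (insert (v, w) F)" using goodD(4)[OF g] w by (auto simp: inj_on_insert)
    then obtain U where U: "U \<subseteq> L" "card U \<le> 2 * M"
      "card (\<Union>(N ` U) - (snd ` insert (v, w) F \<union> Z)) + card (insert (v, w) F \<inter> U \<times> UNIV)
         < K * card U"
      using ng[OF w] goodD[OF g] w v(1) unfolding good_def by auto
    have eq: "\<Union>(N ` U) - (snd ` insert (v, w) F \<union> Z) = (\<Union>(N ` U) - ?S) - {w}" by auto
    have le: "K * card U \<le> capacity F Z U" by (rule goodD(6)[OF g U(1,2)])
    have dec: "card (\<Union>(N ` U) - ?S) \<le> card ((\<Union>(N ` U) - ?S) - {w}) + 1"
      using card_Diff_singleton_if[of "\<Union>(N ` U) - ?S" w] by (auto split: if_splits)
    \<comment> \<open>For a set containing \<open>v\<close>, the new credit makes up for the loss of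
      \<open>w\<close>, so such a set cannot be an obstruction.\<close>
    have vU: "v \<notin> U"
    proof
      assume "v \<in> U"
      then have "insert (v, w) F \<inter> U \<times> UNIV = insert (v, w) (F \<inter> U \<times> UNIV)" by auto
      moreover have "(v, w) \<notin> F" using w by force
      ultimately have "card (insert (v, w) F \<inter> U \<times> UNIV) = card (F \<inter> U \<times> UNIV) + 1"
        using goodD(1)[OF g] by simp
      then show False using U(3) le dec unfolding eq capacity_def by linarith
    qed
    then have eq2: "insert (v, w) F \<inter> U \<times> UNIV = F \<inter> U \<times> UNIV" by auto
    have wN: "w \<in> \<Union>(N ` U)"
    proof (rule ccontr)
      assume "w \<notin> \<Union>(N ` U)"
      then have "\<Union>(N ` U) - ?S - {w} = \<Union>(N ` U) - ?S" by blast
      then show False using U(3) le unfolding eq eq2 capacity_def by simp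
    qed
    have "capacity F Z U \<le> K * card U" using U(3) dec unfolding eq eq2 capacity_def by linarith
    then show ?thesis using capacity_eq_imp_small[OF g b U(1,2)] wN vU by auto
  qed
  moreover have "finite (N v - ?S)" using finite_N by auto
  ultimately obtain U where U: "tight F Z U" "N v - ?S \<subseteq> \<Union>(N ` U)" "{v} \<inter> U = {}"
    using tight_cover[OF g b, of "N v - ?S" "{v}"] by metis
  have finU: "finite U" "U \<subseteq> L" "card U \<le> M"
    using U(1) finite_L finite_subset by (auto simp: tight_def)
  have c: "card (insert v U) = card U + 1" using finU U(3) by simp
  \<comment> \<open>\<open>insert v U\<close> may have \<open>M + 1\<close> slots, which is at most
    \<open>2 * M\<close> by \<open>M_pos\<close>.\<close>
  have "K * card (insert v U) \<le> capacity F Z (insert v U)"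
    using finU v(1) c M_pos by (intro goodD(6)[OF g]) auto
  moreover have "\<Union>(N ` insert v U) - ?S = \<Union>(N ` U) - ?S" using U(2) by auto
  moreover have "card (F \<inter> insert v U \<times> UNIV) = card (F \<inter> U \<times> UNIV) + card (F \<inter> {v} \<times> UNIV)"
    using goodD(1)[OF g] U(3)
    by (subst card_Un_disjoint[symmetric]) (auto intro: arg_cong[where f=card])
  ultimately have "K * (card U + 1) \<le> capacity F Z U + card (F \<inter> {v} \<times> UNIV)"
    unfolding capacity_def c by simp
  then show False using U(1) v(2) unfolding tight_def by simp
qed

lemma good_extend_vertex:
  assumes g: "good F Z" and v: "v \<in> L" "v \<notin> fst ` F"
    and b: "card F + card Z + j \<le> b" "j \<le> K"
  shows "\<exists>F'. good (F \<union> F') Z \<and> F' \<subseteq> {v} \<times> UNIV \<and> F \<inter> F' = {} \<and> card F' = j"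
  using b
proof (induction j)
  case 0
  then show ?case using g by (intro exI[of _ "{}"]) auto
next
  case (Suc j)
  then obtain F' where F': "good (F \<union> F') Z" "F' \<subseteq> {v} \<times> UNIV" "F \<inter> F' = {}" "card F' = j"
    by auto
  have fin: "finite F" "finite F'" using goodD(1)[OF F'(1)] by auto
  have "(F \<union> F') \<inter> {v} \<times> UNIV = F'" using F'(2) v(2) by force
  moreover have "card (F \<union> F') + card Z \<le> b"
    using Suc.prems card_Un_le[of F F'] F'(4) by linarith
  ultimately obtain w where w: "w \<in> N v - (snd ` (F \<union> F') \<union> Z)" "good (insert (v, w) (F \<union> F')) Z"
    using good_extend[OF F'(1) _ v(1)] F'(4) Suc.prems by auto
  have "(v, w) \<notin> F \<union> F'" using w(1) by force
  then show ?case using w(2) F' fin by (intro exI[of _ "insert (v, w) F'"]) auto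
qed

lemma good_extend_set:
  assumes g: "good F Z" and R: "finite R" "R \<subseteq> L" "R \<inter> fst ` F = {}"
    and b: "card F + card Z + K * card R \<le> b"
  shows "\<exists>F'. good (F \<union> F') Z \<and> F' \<subseteq> R \<times> UNIV \<and> F \<inter> F' = {} \<and> card F' = K * card R"
  using R b
proof (induction R rule: finite_induct)
  case empty
  then show ?case using g by (intro exI[of _ "{}"]) auto
next
  case (insert v R)
  then obtain F' where F': "good (F \<union> F') Z" "F' \<subseteq> R \<times> UNIV" "F \<inter> F' = {}" "card F' = K * card R"
    by auto
  have fin: "finite F" "finite F'" using goodD(1)[OF F'(1)] by auto
  have "v \<notin> fst ` (F \<union> F')" using insert F'(2) by auto
  moreover have "card (F \<union> F') + card Z + K \<le> b"
    using insert card_Un_le[of F F'] F'(4) by (simp add: card_insert_disjoint)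
  ultimately obtain G where G: "good (F \<union> F' \<union> G) Z" "G \<subseteq> {v} \<times> UNIV" "(F \<union> F') \<inter> G = {}" "card G = K"
    using good_extend_vertex[OF F'(1), of v K] insert.prems by auto
  have "finite G" using goodD(1)[OF G(1)] by auto
  then have "card (F' \<union> G) = K * card (insert v R)"
    using G fin F'(4) insert by (subst card_Un_disjoint) auto
  then show ?case using F' G by (intro exI[of _ "F' \<union> G"]) (auto simp: Un_assoc)
qed

end


section \<open>Growing trees in a digraph\<close>

text \<open>Reading \<open>Q\<close> as the arc set of a digraph on \<open>UNIV\<close> makes the
  library's shortening of walks to paths available.\<close>

lemma rtrancl_imp_path:
  assumes "(y, x) \<in> Q\<^sup>*"
  shows "\<exists>p. pcas y p x \<and> set p \<subseteq> Q \<and> distinct (pawalk_verts y p) \<and>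
    set (pawalk_verts y p) \<subseteq> insert y (Range Q)"
proof -
  define H where "H = \<lparr>pverts = UNIV, parcs = Q\<rparr>"
  interpret H: pair_wf_digraph H by unfold_locales (auto simp: H_def)
  have awalk: "H.awalk u p v \<longleftrightarrow> set p \<subseteq> Q \<and> pcas u p v" for u p v
    unfolding H.awalk_def by (simp add: H_def)
  have "\<exists>p. H.awalk y p x"
    using assms
  proof (induction rule: converse_rtrancl_induct)
    case base
    have "H.awalk x [] x" by (simp add: awalk)
    then show ?case by blast
  next
    case (step u v)
    then obtain p where "H.awalk v p x" by auto
    then have "H.awalk u ((u, v) # p) x" using step(1) by (simp add: awalk)
    then show ?case by blast
  qed
  then obtain p where p: "H.apath y p x" using H.apath_awalk_to_apath by blast
  have "set (pawalk_verts u p) \<subseteq> insert u (snd ` set p)" if "pcas u p x" for u p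
    using that by (induction p arbitrary: u) force+
  with p show ?thesis by (intro exI[of _ p]) (force simp: H.apath_def awalk)
qed

text \<open>Expansion is assumed for one sign at a time, while sets of slots mix both; passing to
  the more frequent sign loses a factor 2.\<close>

lemma sign_majority:
  fixes U :: "('a \<times> sign) set"
  assumes "finite U"
  obtains W s where "W \<times> {s} \<subseteq> U" "card U \<le> 2 * card W"
proof -
  define S where "S = (\<lambda>s. {v. (v, s) \<in> U})"
  have U: "U = S Plus \<times> {Plus} \<union> S Minus \<times> {Minus}"
    by (auto simp: S_def) (metis sign.exhaust)+
  have "card U \<le> card (S Plus) + card (S Minus)"
    using card_Un_le[of "S Plus \<times> {Plus}" "S Minus \<times> {Minus}"] U by (simp add: card_cartesian_product)
  then have "card U \<le> 2 * card (S Plus) \<or> card U \<le> 2 * card (S Minus)" by linarith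
  moreover have "S s \<times> {s} \<subseteq> U" for s by (auto simp: S_def)
  ultimately show thesis using that by blast
qed

text \<open>In \<open>small_sets\<close>, one factor 2 is spent on passing to a single sign and
  another on up to \<open>K\<close> blocked vertices. In \<open>large_sets\<close>,
  \<open>4 * m\<close> is the largest number of slots considered. In \<open>large_meet\<close>,
  \<open>2 * K * m\<close> is what \<open>good_block\<close> asks for.\<close>

locale digraph_expansion =
  fixes D :: "'a pair_pre_digraph" and A :: "'a set" and K m b :: nat
  assumes digraph: "pair_digraph D"
    and A_sub: "A \<subseteq> pverts D"
    and K_ge: "K \<ge> 2" and m_ge: "m \<ge> 1" and b_ge: "b \<ge> K"
    and small_sets: "\<And>s U. U \<subseteq> pverts D \<Longrightarrow> card U \<le> m \<Longrightarrow>
      4 * K * card U \<le> card (\<Union>u\<in>U. nbrs s D u \<inter> A)"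
    and large_sets: "\<And>s U. U \<subseteq> pverts D \<Longrightarrow> card U = m \<Longrightarrow>
      4 * K * m + b < card (\<Union>u\<in>U. nbrs s D u \<inter> A)"
    and large_meet: "\<And>U W. U \<subseteq> pverts D \<Longrightarrow> card U = m \<Longrightarrow> W \<subseteq> pverts D \<Longrightarrow> card W = m \<Longrightarrow>
      2 * K * m + b < card ((\<Union>u\<in>U. nbrs Plus D u \<inter> A) \<inter> (\<Union>u\<in>W. nbrs Minus D u \<inter> A))"
begin

definition slot_nbrs :: "'a \<times> sign \<Rightarrow> 'a set" where
  "slot_nbrs = (\<lambda>(v, s). nbrs s D v \<inter> A)"

lemma finite_pverts: "finite (pverts D)"
  using digraph unfolding pair_digraph_def pair_fin_digraph_def pair_fin_digraph_axioms_def by simp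

lemma finite_A: "finite A"
  using A_sub finite_pverts finite_subset by blast

lemma finite_UN_slot_nbrs: "finite (\<Union>(slot_nbrs ` U))"
  by (rule finite_subset[OF _ finite_A]) (auto simp: slot_nbrs_def)

lemma card_slot_nbrs_mono:
  assumes "W \<times> {s} \<subseteq> U"
  shows "card (\<Union>u\<in>W. nbrs s D u \<inter> A) \<le> card (\<Union>(slot_nbrs ` U))"
  using assms by (intro card_mono finite_UN_slot_nbrs) (force simp: slot_nbrs_def)

text \<open>Here \<open>M = 2 * m\<close>, because among \<open>2 * m\<close> slots one sign occurs
  at \<open>m\<close> vertices or more.\<close>

sublocale residual_expansion "pverts D \<times> UNIV" slot_nbrs K "2 * m" b
proof
  show "finite (pverts D \<times> (UNIV :: sign set))"
  proof -
    have "(UNIV :: sign set) = {Plus, Minus}" by (auto intro: sign.exhaust)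
    then have "finite (UNIV :: sign set)" by (metis finite.emptyI finite_insert)
    then show ?thesis using finite_pverts by blast
  qed
  show "finite (slot_nbrs v)" for v using finite_UN_slot_nbrs[of "{v}"] by simp
  show "1 \<le> 2 * m" using m_ge by simp
  fix U :: "('a \<times> sign) set"
  assume U: "U \<subseteq> pverts D \<times> UNIV" "2 * m \<le> card U" "card U \<le> 2 * (2 * m)"
  have "finite U" using U(2) m_ge card_gt_0_iff[of U] by linarith
  then obtain W s where W: "W \<times> {s} \<subseteq> U" "card U \<le> 2 * card W" by (rule sign_majority)
  then obtain W' where W': "W' \<subseteq> W" "card W' = m" using U(2) obtain_subset_with_card_n[of m W] by auto
  have "W' \<subseteq> pverts D" using W W' U(1) by blast
  then have "4 * K * m + b < card (\<Union>u\<in>W'. nbrs s D u \<inter> A)" using large_sets W' by blast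
  also have "\<dots> \<le> card (\<Union>(slot_nbrs ` U))" using W W' by (intro card_slot_nbrs_mono) blast
  finally have "4 * K * m + b < card (\<Union>(slot_nbrs ` U))" .
  moreover have "K * card U \<le> K * (4 * m)" using U(3) by (intro mult_le_mono2) simp
  moreover have "K * (4 * m) = 4 * K * m" by simp
  ultimately show "K * card U + b < card (\<Union>(slot_nbrs ` U))" by linarith
qed

text \<open>Blocking \<open>Z\<close> removes at most \<open>K\<close> neighbours, and a nonempty
  \<open>U\<close> has slack \<open>K\<close>: for few vertices from the spare factor 2 in
  \<open>small_sets\<close>, for many from \<open>K \<le> b\<close>.\<close>

lemma good_empty:
  assumes Z: "finite Z" "card Z \<le> K"
  shows "good {} Z"
proof -
  have "K * card U \<le> card (\<Union>(slot_nbrs ` U) - Z)"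
    if U: "U \<subseteq> pverts D \<times> UNIV" "card U \<le> 2 * (2 * m)" for U
  proof (cases "U = {}")
    case False
    have finU: "finite U" using U(1) finite_L finite_subset by blast
    then obtain W s where W: "W \<times> {s} \<subseteq> U" "card U \<le> 2 * card W" by (rule sign_majority)
    have WX: "W \<subseteq> pverts D" using W U(1) by blast
    have U_pos: "card U \<ge> 1" using False finU by (simp add: Suc_leI card_gt_0_iff)
    have "K * card U + K \<le> card (\<Union>(slot_nbrs ` U))"
    proof (cases "card W \<le> m")
      case True
      have "K * card U + K \<le> 2 * (K * card U)" using U_pos by (cases "card U") auto
      also have "\<dots> \<le> 4 * K * card W" using W(2) mult_le_mono2[of "card U" "2 * card W" K] by simp
      also have "\<dots> \<le> card (\<Union>u\<in>W. nbrs s D u \<inter> A)" by (rule small_sets[OF WX True])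
      also have "\<dots> \<le> card (\<Union>(slot_nbrs ` U))" by (rule card_slot_nbrs_mono[OF W(1)])
      finally show ?thesis .
    next
      case False
      then obtain W' where W': "W' \<subseteq> W" "card W' = m"
        using obtain_subset_with_card_n[of m W] by auto
      have "4 * K * m + b < card (\<Union>u\<in>W'. nbrs s D u \<inter> A)" using large_sets W' WX by blast
      also have "\<dots> \<le> card (\<Union>(slot_nbrs ` U))" using W W' by (intro card_slot_nbrs_mono) blast
      finally have "4 * K * m + b < card (\<Union>(slot_nbrs ` U))" .
      moreover have "K * card U \<le> K * (4 * m)" using U(2) by (intro mult_le_mono2) simp
      moreover have "K * (4 * m) = 4 * K * m" by simp
      ultimately show ?thesis using b_ge by linarith
    qed
    then show ?thesis
      using diff_card_le_card_Diff[OF Z(1), of "\<Union>(slot_nbrs ` U)"] Z(2) by linarith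
  qed simp
  then show ?thesis using Z(1) by (simp add: good_def)
qed

text \<open>In a clean state the slots of an available vertex of \<open>A\<close> are all unused.\<close>

definition clean :: "(('a \<times> sign) \<times> 'a) set \<Rightarrow> 'a set \<Rightarrow> bool" where
  "clean F Z \<longleftrightarrow> fst ` F \<inter> (A - Z - snd ` F) \<times> UNIV = {}"

text \<open>The steps point away from the root for both signs. For \<open>Minus\<close> they reverse
  the arcs of \<open>D\<close>, hence the converse relation in \<open>connect_pair\<close>.\<close>

definition steps :: "sign \<Rightarrow> (('a \<times> sign) \<times> 'a) set \<Rightarrow> ('a \<times> 'a) set" where
  "steps s E = {(u, v). ((u, s), v) \<in> E}"

text \<open>This alone does not make \<open>E\<close> a tree; reachability from \<open>y\<close> is
  stated separately through \<open>steps\<close>.\<close>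

definition rooted :: "sign \<Rightarrow> 'a \<Rightarrow> (('a \<times> sign) \<times> 'a) set \<Rightarrow> bool" where
  "rooted s y E \<longleftrightarrow> fst ` E \<subseteq> insert y (snd ` E) \<times> {s}"

lemma good_snd_A: "good F Z \<Longrightarrow> snd ` F \<subseteq> A"
  by (drule goodD(3)) (auto simp: slot_nbrs_def)

lemma clean_rooted:
  assumes "clean F Z" "rooted s y E" "y \<notin> A - Z"
  shows "clean (F \<union> E) Z"
  using assms unfolding clean_def rooted_def by (auto simp: image_Un)

text \<open>\<open>R\<close> is the current frontier. A round gives each of its vertices
  \<open>K\<close> children, and growth ends once \<open>R\<close> has \<open>m\<close> elements;
  the last round thus starts below \<open>m\<close>, whence \<open>card R \<le> K * m\<close>. As
  \<open>K \<ge> 2\<close>, levels at least double, so the tree has at most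
  \<open>2 * card R\<close> pairs. The set \<open>E\<close> records the branch to a leaf, so that
  the rest can be released later.\<close>

lemma grow_tree:
  assumes g: "good F Z" and cl: "clean F Z"
    and y: "y \<in> pverts D" "y \<notin> A - Z" "(y, s) \<notin> fst ` F"
    and b: "card F + card Z + 2 * K * m \<le> b"
  shows "\<exists>F' R. good (F \<union> F') Z \<and> F \<inter> F' = {} \<and> card F' \<le> 2 * card R \<and>
    min m (K ^ j) \<le> card R \<and> card R \<le> K * m \<and> R \<subseteq> insert y (snd ` F') \<and> rooted s y F' \<and>
    (\<forall>r\<in>R. (r, s) \<notin> fst ` F' \<and>
      (\<exists>E\<subseteq>F'. card E \<le> j \<and> rooted s y E \<and> (y, r) \<in> (steps s E)\<^sup>*))"
proof (induction j)
  case 0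
  have "(y, y) \<in> (steps s {})\<^sup>*" by simp
  then show ?case using g K_ge m_ge y
    by (intro exI[of _ "{}"] exI[of _ "{y}"]) (auto simp: rooted_def)
next
  case (Suc j)
  then obtain F' R where IH: "good (F \<union> F') Z" "F \<inter> F' = {}" "card F' \<le> 2 * card R"
    "min m (K ^ j) \<le> card R" "card R \<le> K * m" "R \<subseteq> insert y (snd ` F')" "rooted s y F'"
    and R: "\<And>r. r \<in> R \<Longrightarrow> (r, s) \<notin> fst ` F'"
    and path: "\<And>r. r \<in> R \<Longrightarrow> \<exists>E\<subseteq>F'. card E \<le> j \<and> rooted s y E \<and> (y, r) \<in> (steps s E)\<^sup>*"
    by blast
  have fin: "finite F" "finite F'" using goodD(1)[OF IH(1)] by auto
  have finR: "finite R" using IH(6) fin finite_subset by blast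
  show ?case
  proof (cases "card R \<ge> m")
    case True
    moreover have "\<exists>E\<subseteq>F'. card E \<le> Suc j \<and> rooted s y E \<and> (y, r) \<in> (steps s E)\<^sup>*" if "r \<in> R" for r
      using path[OF that] le_SucI by blast
    ultimately show ?thesis using IH R by (intro exI[of _ F'] exI[of _ R]) auto
  next
    case False
    have snd_new: "v \<in> A - Z - snd ` F" if "v \<in> snd ` F'" for v
    proof -
      from that obtain e where e: "(e, v) \<in> F'" by force
      have "v \<in> A" using good_snd_A[OF IH(1)] that by auto
      moreover have "v \<notin> Z" using goodD(5)[OF IH(1)] that by auto
      moreover have "v \<notin> snd ` F"
      proof
        assume "v \<in> snd ` F"
        then obtain e' where "(e', v) \<in> F" by force
        then have "e = e'" using inj_onD[OF goodD(4)[OF IH(1)], of "(e, v)" "(e', v)"] e by simp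
        then show False using e \<open>(e', v) \<in> F\<close> IH(2) by auto
      qed
      ultimately show ?thesis by simp
    qed
    \<comment> \<open>A leaf other than \<open>y\<close> was available before the tree was grown, so
      by \<open>clean\<close> none of its slots was in use.\<close>
    have "(r, s) \<notin> fst ` F" if "r \<in> R" for r
      using IH(6) that y(3) snd_new[of r] cl unfolding clean_def by blast
    then have disj: "(R \<times> {s}) \<inter> fst ` (F \<union> F') = {}" using R by auto
    have RL: "R \<times> {s} \<subseteq> pverts D \<times> UNIV" using IH(6) snd_new A_sub y(1) by auto
    have cRs: "card (R \<times> {s}) = card R" by (simp add: card_cartesian_product)
    have KR: "2 * card R \<le> K * card R" "K * card R \<le> K * m" using K_ge False by auto
    have "card (F \<union> F') + card Z + K * card (R \<times> {s}) \<le> b"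
      using card_Un_le[of F F'] IH(3) b KR unfolding cRs by linarith
    then obtain G where G: "good (F \<union> F' \<union> G) Z" "G \<subseteq> (R \<times> {s}) \<times> UNIV" "(F \<union> F') \<inter> G = {}"
      "card G = K * card R"
      using good_extend_set[OF IH(1) _ RL disj] finR unfolding cRs by auto
    have finG: "finite G" using goodD(1)[OF G(1)] by auto
    define F'' where "F'' = F' \<union> G"
    define R' where "R' = snd ` G"
    have inj: "inj_on snd (F \<union> F' \<union> G)" by (rule goodD(4)[OF G(1)])
    have cR': "card R' = K * card R"
      unfolding R'_def using inj G(4) by (subst card_image) (auto intro: inj_on_subset)
    have sep: "snd ` (F \<union> F') \<inter> R' = {}"
      unfolding R'_def using inj_on_image_Int[OF inj, of "F \<union> F'" G] G(3) by auto
    have cF'': "card F'' \<le> 2 * card R'"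
      unfolding F''_def cR' using card_Un_le[of F' G] G(4) IH(3) KR by linarith
    have heads: "fst ` F'' \<subseteq> insert y (snd ` F') \<times> {s}"
    proof -
      have "fst ` G \<subseteq> R \<times> {s}" using G(2) by auto
      also have "\<dots> \<subseteq> insert y (snd ` F') \<times> {s}" using IH(6) by auto
      finally show ?thesis using IH(7) unfolding rooted_def F''_def by (simp add: image_Un)
    qed
    then have root'': "rooted s y F''" unfolding rooted_def F''_def by (auto simp: image_Un)
    have R'new: "(r, s) \<notin> fst ` F''" if r: "r \<in> R'" for r
    proof
      assume "(r, s) \<in> fst ` F''"
      then have "r \<in> insert y (snd ` F')" using heads by (auto dest: subsetD)
      moreover have "r \<in> A - Z"
        using r good_snd_A[OF G(1)] goodD(5)[OF G(1)] unfolding R'_def by auto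
      ultimately show False using y(2) sep r by auto
    qed
    have path'': "\<exists>E\<subseteq>F''. card E \<le> Suc j \<and> rooted s y E \<and> (y, w) \<in> (steps s E)\<^sup>*" if w: "w \<in> R'" for w
    proof -
      obtain r where r: "((r, s), w) \<in> G" "r \<in> R" using w G(2) unfolding R'_def by force
      then obtain E where E: "E \<subseteq> F'" "card E \<le> j" "rooted s y E" "(y, r) \<in> (steps s E)\<^sup>*"
        using path by blast
      let ?E = "insert ((r, s), w) E"
      \<comment> \<open>The parent \<open>r\<close> must itself be reached by \<open>E\<close>;
        otherwise adding its slot would break \<open>rooted\<close>.\<close>
      have "r = y \<or> r \<in> Range (steps s E)" using E(4) by (metis Range.intros rtranclE)
      then have "r \<in> insert y (snd ` E)" by (force simp: steps_def)
      then have "rooted s y ?E" using E(3) unfolding rooted_def by auto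
      moreover have "card ?E \<le> Suc j" using card_insert_le_m1[of "Suc j" E] E(2) by simp
      moreover have "(y, w) \<in> (steps s ?E)\<^sup>*"
      proof (rule rtrancl_into_rtrancl)
        show "(y, r) \<in> (steps s ?E)\<^sup>*"
          using E(4) by (rule rtrancl_mono[THEN subsetD, rotated]) (auto simp: steps_def)
        show "(r, w) \<in> steps s ?E" by (simp add: steps_def)
      qed
      moreover have "?E \<subseteq> F''" using E(1) r(1) unfolding F''_def by auto
      ultimately show ?thesis by (intro exI[of _ ?E]) simp
    qed
    have "min m (K ^ Suc j) \<le> card R'"
    proof -
      have "K ^ j \<le> card R" using IH(4) False by auto
      then have "K ^ Suc j \<le> card R'" using cR' by simp
      then show ?thesis by simp
    qed
    moreover have "card R' \<le> K * m" using cR' KR by simp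
    moreover have "good (F \<union> F'') Z" "F \<inter> F'' = {}" "R' \<subseteq> insert y (snd ` F'')"
      using G IH unfolding F''_def R'_def by (auto simp: Un_assoc)
    ultimately show ?thesis using cF'' root'' R'new path''
      by (intro exI[of _ F''] exI[of _ R']) simp
  qed
qed

end


section \<open>Linking pairs of vertices and closing the cycle\<close>

lemma pcas_append: "pcas u p w \<Longrightarrow> pcas w q v \<Longrightarrow> pcas u (p @ q) v"
  by (induction p arbitrary: u) auto

lemma pawalk_verts_append:
  "pcas u p w \<Longrightarrow> pawalk_verts w q = w # vs \<Longrightarrow> pawalk_verts u (p @ q) = pawalk_verts u p @ vs"
  by (induction p arbitrary: u) auto

lemma pcas_arc_ends: "pcas u p v \<Longrightarrow> e \<in> set p \<Longrightarrow> {fst e, snd e} \<subseteq> set (pawalk_verts u p)"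
proof (induction p arbitrary: u)
  case (Cons a p)
  have "snd a \<in> set (pawalk_verts (snd a) p)" by (cases p) (use Cons.prems in auto)
  then show ?case using Cons by auto
qed simp

text \<open>Stated for an open chain, with \<open>us\<close> listing the tails and one final end, so
  that induction applies; the walk closes when the first and last entries of \<open>us\<close>
  agree. Each link starts at the head of its arc, so no vertex is listed twice by the concatenation
  itself.\<close>

lemma closed_walk_through_arcs:
  assumes "length ps = length es" "length us = Suc (length es)"
    and "\<And>i. i < length es \<Longrightarrow> fst (es ! i) = us ! i \<and> pcas (snd (es ! i)) (ps ! i) (us ! Suc i)"
  shows "pcas (us ! 0) (concat (map2 (#) es ps)) (last us) \<and>
    pawalk_verts (us ! 0) (concat (map2 (#) es ps)) =
      us ! 0 # concat (map2 (\<lambda>e. pawalk_verts (snd e)) es ps)"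
  using assms
proof (induction es arbitrary: ps us)
  case Nil
  then show ?case by (cases us) auto
next
  case (Cons e es)
  obtain p ps' where ps: "ps = p # ps'" using Cons.prems(1) by (cases ps) auto
  obtain u us' where us: "us = u # us'" using Cons.prems(2) by (cases us) auto
  have IH: "pcas (us' ! 0) (concat (map2 (#) es ps')) (last us') \<and>
    pawalk_verts (us' ! 0) (concat (map2 (#) es ps')) =
      us' ! 0 # concat (map2 (\<lambda>e. pawalk_verts (snd e)) es ps')"
  proof (rule Cons.IH)
    fix i assume "i < length es"
    then show "fst (es ! i) = us' ! i \<and> pcas (snd (es ! i)) (ps' ! i) (us' ! Suc i)"
      using Cons.prems(3)[of "Suc i"] ps us by simp
  qed (use Cons.prems ps us in auto)
  have e: "fst e = u" "pcas (snd e) p (us' ! 0)" using Cons.prems(3)[of 0] ps us by auto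
  have "us' \<noteq> []" using Cons.prems(2) us by auto
  then show ?case
    using e IH pcas_append[OF e(2)] pawalk_verts_append[OF e(2)] by (simp add: ps us)
qed

lemma subseq_concat_map2_Cons:
  "length ps = length es \<Longrightarrow> subseq es (concat (map2 (#) es ps))"
proof (induction es arbitrary: ps)
  case (Cons e es)
  then obtain p ps' where "ps = p # ps'" by (cases ps) auto
  then show ?case using Cons by (simp add: list_emb_append2)
qed simp

lemma distinct_concat_map2I:
  assumes "length ps = length es"
    and "\<And>i. i < length es \<Longrightarrow> distinct (f (es ! i) (ps ! i))"
    and "\<And>i j. i < j \<Longrightarrow> j < length es \<Longrightarrow> set (f (es ! i) (ps ! i)) \<inter> set (f (es ! j) (ps ! j)) = {}"
  shows "distinct (concat (map2 f es ps))"
  using assms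
proof (induction es arbitrary: ps)
  case (Cons e es)
  obtain p ps' where ps: "ps = p # ps'" using Cons.prems(1) by (cases ps) auto
  have "distinct (concat (map2 f es ps'))"
  proof (rule Cons.IH)
    fix i assume "i < length es"
    then show "distinct (f (es ! i) (ps' ! i))" using Cons.prems(2)[of "Suc i"] ps by simp
  next
    fix i j assume "i < j" "j < length es"
    then show "set (f (es ! i) (ps' ! i)) \<inter> set (f (es ! j) (ps' ! j)) = {}"
      using Cons.prems(3)[of "Suc i" "Suc j"] ps by simp
  qed (use Cons.prems ps in auto)
  moreover have "distinct (f e p)" using Cons.prems(2)[of 0] ps by simp
  moreover have "set (f e p) \<inter> set (f (es ! j) (ps' ! j)) = {}" if "j < length es" for j
    using Cons.prems(3)[of 0 "Suc j"] that ps by simp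
  then have "set (f e p) \<inter> set (concat (map2 f es ps')) = {}"
    by (auto simp: set_zip)
  ultimately show ?case using ps by simp
qed simp

section \<open>Disjoint links between prescribed pairs\<close>

context digraph_expansion
begin

text \<open>Each tree costs at most \<open>2 * K * m\<close> of the budget while it is being used.
  Afterwards only one branch of length at most \<open>h\<close> of each tree survives, plus the
  meeting vertex \<open>w\<close>, which is blocked through \<open>Z\<close> without credit.\<close>

lemma connect_pair:
  assumes g: "good F Z" and cl: "clean F Z"
    and y: "y \<in> pverts D" "y \<notin> A - Z" "(y, Plus) \<notin> fst ` F"
    and x: "x \<in> pverts D" "x \<notin> A - Z" "(x, Minus) \<notin> fst ` F"
    and b: "card F + card Z + 4 * K * m \<le> b" and h: "m \<le> K ^ h"
  obtains F' w p where "good (F \<union> F') (insert w Z)" "clean (F \<union> F') (insert w Z)"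
    "card F' \<le> 2 * h" "insert w (snd ` F') \<subseteq> A - Z - snd ` F"
    "fst ` F' \<subseteq> insert y (snd ` F') \<times> {Plus} \<union> insert x (snd ` F') \<times> {Minus}"
    "pcas y p x" "set p \<subseteq> parcs D" "distinct (pawalk_verts y p)"
    "set (pawalk_verts y p) \<subseteq> {y, x} \<union> insert w (snd ` F')"
proof -
  have m: "min m (K ^ h) = m" using h by simp
  obtain F1 R1 where F1: "good (F \<union> F1) Z" "F \<inter> F1 = {}" "card F1 \<le> 2 * card R1" "m \<le> card R1"
      "card R1 \<le> K * m" "R1 \<subseteq> insert y (snd ` F1)" "rooted Plus y F1"
    and path1: "\<And>r. r \<in> R1 \<Longrightarrow> \<exists>E\<subseteq>F1. card E \<le> h \<and> rooted Plus y E \<and> (y, r) \<in> (steps Plus E)\<^sup>*"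
    using grow_tree[OF g cl y, of h] b unfolding m by auto
  have cF1: "card (F \<union> F1) \<le> card F + 2 * K * m"
    using card_Un_le[of F F1] F1(3,5) by linarith
  have cl1: "clean (F \<union> F1) Z" by (rule clean_rooted[OF cl F1(7) y(2)])
  \<comment> \<open>The first tree uses \<open>Plus\<close> slots only, so the \<open>Minus\<close>
    slot of \<open>x\<close> is still free.\<close>
  have "(x, Minus) \<notin> fst ` (F \<union> F1)" using x(3) F1(7) unfolding rooted_def by blast
  moreover have "card (F \<union> F1) + card Z + 2 * K * m \<le> b" using cF1 b by linarith
  ultimately obtain F2 R2 where F2: "good (F \<union> F1 \<union> F2) Z" "(F \<union> F1) \<inter> F2 = {}"
      "card F2 \<le> 2 * card R2" "m \<le> card R2"
      "card R2 \<le> K * m" "R2 \<subseteq> insert x (snd ` F2)" "rooted Minus x F2"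
    and path2: "\<And>r. r \<in> R2 \<Longrightarrow> \<exists>E\<subseteq>F2. card E \<le> h \<and> rooted Minus x E \<and> (x, r) \<in> (steps Minus E)\<^sup>*"
    using grow_tree[OF F1(1) cl1 x(1,2), of Minus h] unfolding m by auto
  let ?F = "F \<union> F1 \<union> F2"
  have fin: "finite ?F" "finite Z" using goodD(1,2)[OF F2(1)] by auto
  have cF2: "card ?F + card Z \<le> b"
    using card_Un_le[of "F \<union> F1" F2] F2(3,5) cF1 b by linarith
  obtain W1 where W1: "W1 \<subseteq> R1" "card W1 = m" using F1(4) obtain_subset_with_card_n[of m R1] by auto
  obtain W2 where W2: "W2 \<subseteq> R2" "card W2 = m" using F2(4) obtain_subset_with_card_n[of m R2] by auto
  have A: "snd ` ?F \<subseteq> A" by (rule good_snd_A[OF F2(1)])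
  have "W1 \<subseteq> pverts D" "W2 \<subseteq> pverts D"
    using W1(1) W2(1) F1(6) F2(6) A A_sub x(1) y(1) by blast+
  then have meet: "2 * K * m + b < card ((\<Union>u\<in>W1. nbrs Plus D u \<inter> A) \<inter> (\<Union>u\<in>W2. nbrs Minus D u \<inter> A))"
    (is "_ < card ?N") using large_meet W1(2) W2(2) by blast
  define C where "C = ?N - (snd ` ?F \<union> Z)"
  have "finite ?N" by (rule finite_subset[OF _ finite_A]) auto
  then have finC: "finite C" unfolding C_def by auto
  have "card (snd ` ?F \<union> Z) \<le> b"
    using card_Un_le[of "snd ` ?F" Z] card_image_le[OF fin(1), of snd] cF2 by linarith
  moreover have "card ?N - card (snd ` ?F \<union> Z) \<le> card C"
    unfolding C_def using fin by (intro diff_card_le_card_Diff) auto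
  \<comment> \<open>This is the threshold \<open>K * M\<close> of \<open>good_block\<close>, as
    \<open>M = 2 * m\<close> here.\<close>
  ultimately have "card C > K * (2 * m)" using meet by (simp add: mult.left_commute)
  then obtain w where w: "w \<in> C" "good ?F (insert w Z)"
    using good_block[OF F2(1) cF2 finC] unfolding C_def by blast
  obtain r1 where r1: "r1 \<in> W1" "(r1, w) \<in> parcs D" "w \<in> A" using w(1) unfolding C_def by auto
  obtain r2 where r2: "r2 \<in> W2" "(w, r2) \<in> parcs D" using w(1) unfolding C_def by auto
  obtain E1 where E1: "E1 \<subseteq> F1" "card E1 \<le> h" "rooted Plus y E1" "(y, r1) \<in> (steps Plus E1)\<^sup>*"
    using path1 r1(1) W1(1) by blast
  obtain E2 where E2: "E2 \<subseteq> F2" "card E2 \<le> h" "rooted Minus x E2" "(x, r2) \<in> (steps Minus E2)\<^sup>*"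
    using path2 r2(1) W2(1) by blast
  let ?E = "E1 \<union> E2"
  have inj: "inj_on snd ?F" by (rule goodD(4)[OF F2(1)])
  have new: "insert w (snd ` ?E) \<subseteq> A - Z - snd ` F"
  proof -
    have "w \<in> A - Z - snd ` F" using w(1) r1(3) unfolding C_def by auto
    moreover have "snd ` ?E \<subseteq> A - Z" using A goodD(5)[OF F2(1)] E1(1) E2(1) by blast
    moreover have "snd ` F \<inter> snd ` ?E = snd ` (F \<inter> ?E)"
      using inj_on_image_Int[OF inj, of F ?E] E1(1) E2(1) by blast
    moreover have "F \<inter> ?E = {}" using F1(2) F2(2) E1(1) E2(1) by blast
    ultimately show ?thesis by auto
  qed
  have good: "good (F \<union> ?E) (insert w Z)"
    using good_subset[OF w(2), of "F \<union> ?E"] E1(1) E2(1) by blast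
  have "clean (F \<union> E1 \<union> E2) Z"
    by (intro clean_rooted[OF _ E2(3) x(2)] clean_rooted[OF cl E1(3) y(2)])
  then have clean: "clean (F \<union> ?E) (insert w Z)" unfolding clean_def by (auto simp: Un_assoc)
  \<comment> \<open>The branch from \<open>y\<close> to \<open>r1\<close>, the two arcs through
    \<open>w\<close>, and the branch of the in-tree turned round so that it leads from
    \<open>r2\<close> to \<open>x\<close>.\<close>
  define Q where "Q = steps Plus E1 \<union> {(r1, w), (w, r2)} \<union> (steps Minus E2)\<inverse>"
  have "(y, r1) \<in> Q\<^sup>*" using E1(4) rtrancl_mono[of "steps Plus E1" Q] unfolding Q_def by blast
  moreover have "(r1, w) \<in> Q" "(w, r2) \<in> Q" unfolding Q_def by auto
  moreover have "(r2, x) \<in> Q\<^sup>*"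
    using E2(4) rtrancl_mono[of "(steps Minus E2)\<inverse>" Q] unfolding Q_def rtrancl_converse by blast
  ultimately have yx: "(y, x) \<in> Q\<^sup>*" by (meson rtrancl.rtrancl_into_rtrancl rtrancl_trans)
  have "?F \<subseteq> Sigma (pverts D \<times> UNIV) slot_nbrs" by (rule goodD(3)[OF F2(1)])
  then have "steps Plus E1 \<subseteq> parcs D" "(steps Minus E2)\<inverse> \<subseteq> parcs D"
    using E1(1) E2(1) unfolding steps_def slot_nbrs_def by auto
  then have Qp: "Q \<subseteq> parcs D" unfolding Q_def using r1 r2 by auto
  have "Range (steps Plus E1) \<subseteq> snd ` E1" by (force simp: steps_def)
  moreover have "Domain (steps Minus E2) \<subseteq> insert x (snd ` E2)"
    using E2(3) unfolding rooted_def steps_def by force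
  moreover have "r2 \<in> insert x (snd ` E2)"
  proof -
    have "r2 = x \<or> r2 \<in> Range (steps Minus E2)" using E2(4) by (metis Range.intros rtranclE)
    then show ?thesis by (force simp: steps_def)
  qed
  ultimately have RQ: "insert y (Range Q) \<subseteq> {y, x} \<union> insert w (snd ` ?E)"
    unfolding Q_def by auto
  obtain p where p: "pcas y p x" "set p \<subseteq> Q" "distinct (pawalk_verts y p)"
    "set (pawalk_verts y p) \<subseteq> insert y (Range Q)"
    using rtrancl_imp_path[OF yx] by blast
  have "card ?E \<le> 2 * h" using card_Un_le[of E1 E2] E1(2) E2(2) by linarith
  moreover have "fst ` ?E \<subseteq> insert y (snd ` ?E) \<times> {Plus} \<union> insert x (snd ` ?E) \<times> {Minus}"
    using E1(3) E2(3) unfolding rooted_def image_Un by (intro Un_least) (auto dest: subsetD)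
  ultimately show thesis
    using that[OF good clean _ new _ p(1) _ p(3)] subset_trans[OF p(2) Qp] subset_trans[OF p(4) RQ]
    by simp
qed

text \<open>\<open>I\<close> is a reserved set that contains the interior of the link; shortening
  the walk to a path may leave some of its vertices off the link.\<close>

definition links :: "'a set \<Rightarrow> 'a \<times> 'a \<Rightarrow> ('a \<times> 'a) list \<Rightarrow> 'a set \<Rightarrow> bool" where
  "links Z q p I \<longleftrightarrow> pcas (fst q) p (snd q) \<and> set p \<subseteq> parcs D \<and> distinct (pawalk_verts (fst q) p) \<and>
     set (pawalk_verts (fst q) p) \<subseteq> {fst q, snd q} \<union> I \<and> I \<subseteq> A - Z"

text \<open>The condition on the used slots ensures that the next pair finds the \<open>Plus\<close>
  slot of its first vertex and the \<open>Minus\<close> slot of its second vertex free.\<close>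

definition linkage :: "'a set \<Rightarrow> ('a \<times> 'a) list \<Rightarrow> ('a \<times> 'a) list list \<Rightarrow> 'a set list \<Rightarrow>
    (('a \<times> sign) \<times> 'a) set \<Rightarrow> 'a set \<Rightarrow> bool" where
  "linkage Z0 qs ps Is F Z \<longleftrightarrow> length ps = length qs \<and> length Is = length qs \<and> Z0 \<subseteq> Z \<and>
    fst ` F \<subseteq> (A - Z0) \<times> UNIV \<union> fst ` set qs \<times> {Plus} \<union> snd ` set qs \<times> {Minus} \<and>
    (\<forall>i<length qs. links Z0 (qs ! i) (ps ! i) (Is ! i) \<and> Is ! i \<subseteq> snd ` F \<union> Z) \<and>
    (\<forall>i j. i < j \<longrightarrow> j < length qs \<longrightarrow> Is ! i \<inter> Is ! j = {})"

text \<open>A finished link keeps at most \<open>2 * h\<close> pairs in \<open>F\<close> and one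
  vertex in \<open>Z\<close>, whence \<open>2 * h + 1\<close>. The term \<open>4 * K * m\<close>
  pays for the two trees of the link under construction and is recovered afterwards.\<close>

lemma connect_pairs:
  assumes "distinct (map fst qs)" "distinct (map snd qs)"
    and "\<And>q. q \<in> set qs \<Longrightarrow> fst q \<in> pverts D - (A - Z0) \<and> snd q \<in> pverts D - (A - Z0)"
    and Z0: "finite Z0" "card Z0 \<le> K"
    and "card Z0 + (2 * h + 1) * length qs + 4 * K * m \<le> b" and h: "m \<le> K ^ h"
  shows "\<exists>ps Is F Z. linkage Z0 qs ps Is F Z \<and> good F Z \<and> clean F Z \<and>
    card F + card Z \<le> card Z0 + (2 * h + 1) * length qs"
  using assms(1,2,3,6)
proof (induction qs rule: rev_induct)
  case Nil
  have "linkage Z0 [] [] [] {} Z0" by (simp add: linkage_def)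
  moreover have "clean {} Z0" by (simp add: clean_def)
  moreover have "good {} Z0" by (rule good_empty[OF Z0])
  moreover have "card {} + card Z0 \<le> card Z0 + (2 * h + 1) * length []" by simp
  ultimately show ?case by blast
next
  case (snoc q qs)
  let ?l = "length qs"
  have "\<exists>ps Is F Z. linkage Z0 qs ps Is F Z \<and> good F Z \<and> clean F Z \<and>
    card F + card Z \<le> card Z0 + (2 * h + 1) * length qs"
  proof (rule snoc.IH)
    show "distinct (map fst qs)" "distinct (map snd qs)" using snoc.prems(1,2) by auto
    show "fst r \<in> pverts D - (A - Z0) \<and> snd r \<in> pverts D - (A - Z0)" if "r \<in> set qs" for r
      using snoc.prems(3)[of r] that by simp
    show "card Z0 + (2 * h + 1) * length qs + 4 * K * m \<le> b" using snoc.prems(4) by simp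
  qed
  then obtain ps Is F Z where link: "linkage Z0 qs ps Is F Z"
    and g: "good F Z" and cl: "clean F Z"
    and c: "card F + card Z \<le> card Z0 + (2 * h + 1) * ?l"
    by blast
  have len: "length ps = ?l" "length Is = ?l" and Z: "Z0 \<subseteq> Z"
    and f: "fst ` F \<subseteq> (A - Z0) \<times> UNIV \<union> fst ` set qs \<times> {Plus} \<union> snd ` set qs \<times> {Minus}"
    using link unfolding linkage_def by simp_all
  have l: "links Z0 (qs ! i) (ps ! i) (Is ! i)" "Is ! i \<subseteq> snd ` F \<union> Z" if "i < ?l" for i
    using link that unfolding linkage_def by simp_all
  have d: "Is ! i \<inter> Is ! j = {}" if "i < j" "j < ?l" for i j
    using link that unfolding linkage_def by simp
  obtain y x where q: "q = (y, x)" by (cases q)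
  have ends: "y \<in> pverts D - (A - Z0)" "x \<in> pverts D - (A - Z0)"
    using snoc.prems(3)[of q] q by auto
  have "y \<notin> fst ` set qs" "x \<notin> snd ` set qs" using snoc.prems(1,2) q by auto
  then have unused: "(y, Plus) \<notin> fst ` F" "(x, Minus) \<notin> fst ` F" using f ends by blast+
  have bb: "card F + card Z + 4 * K * m \<le> b" using c snoc.prems(4) by simp
  obtain F' w p where F': "good (F \<union> F') (insert w Z)" "clean (F \<union> F') (insert w Z)"
    "card F' \<le> 2 * h" "insert w (snd ` F') \<subseteq> A - Z - snd ` F"
    "fst ` F' \<subseteq> insert y (snd ` F') \<times> {Plus} \<union> insert x (snd ` F') \<times> {Minus}"
    and p: "pcas y p x" "set p \<subseteq> parcs D" "distinct (pawalk_verts y p)"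
    "set (pawalk_verts y p) \<subseteq> {y, x} \<union> insert w (snd ` F')"
    by (rule connect_pair[OF g cl _ _ unused(1) _ _ unused(2) bb h]) (use ends Z in auto)
  let ?I = "insert w (snd ` F')"
  have "links Z0 q p ?I" using p F'(4) Z unfolding links_def q by auto
  then have lk: "links Z0 ((qs @ [q]) ! i) ((ps @ [p]) ! i) ((Is @ [?I]) ! i)" if "i < Suc ?l" for i
    using that l(1)[of i] len by (cases "i = ?l") (auto simp: nth_append less_Suc_eq)
  have used: "(Is @ [?I]) ! i \<subseteq> snd ` (F \<union> F') \<union> insert w Z" if "i < Suc ?l" for i
  proof (cases "i = ?l")
    case True
    then have "(Is @ [?I]) ! i = ?I" using len by (simp add: nth_append)
    then show ?thesis by auto
  next
    case False
    then have "(Is @ [?I]) ! i = Is ! i" using that len by (simp add: nth_append)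
    then show ?thesis using l(2)[of i] False that by auto
  qed
  have dj: "(Is @ [?I]) ! i \<inter> (Is @ [?I]) ! j = {}" if "i < j" "j < Suc ?l" for i j
  proof (cases "j = ?l")
    case True
    then have "(Is @ [?I]) ! i = Is ! i" "(Is @ [?I]) ! j = ?I" using that len by (auto simp: nth_append)
    moreover have "Is ! i \<subseteq> snd ` F \<union> Z" using l(2) that True by auto
    ultimately show ?thesis using F'(4) by auto
  next
    case False
    then show ?thesis using that d[of i j] len by (auto simp: nth_append)
  qed
  have fs: "fst ` (F \<union> F') \<subseteq> (A - Z0) \<times> UNIV \<union> fst ` set (qs @ [q]) \<times> {Plus}
      \<union> snd ` set (qs @ [q]) \<times> {Minus}"
  proof -
    have s: "snd ` F' \<subseteq> A - Z0" using F'(4) Z by auto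
    have "insert y (snd ` F') \<times> {Plus} \<union> insert x (snd ` F') \<times> {Minus}
        \<subseteq> (A - Z0) \<times> UNIV \<union> {y} \<times> {Plus} \<union> {x} \<times> {Minus}" using s by auto
    with F'(5) have "fst ` F' \<subseteq> (A - Z0) \<times> UNIV \<union> {y} \<times> {Plus} \<union> {x} \<times> {Minus}"
      by (rule subset_trans)
    moreover have "\<dots> \<subseteq> (A - Z0) \<times> UNIV \<union> fst ` set (qs @ [q]) \<times> {Plus} \<union> snd ` set (qs @ [q]) \<times> {Minus}"
      unfolding q by auto
    moreover have "fst ` F \<subseteq> (A - Z0) \<times> UNIV \<union> fst ` set (qs @ [q]) \<times> {Plus} \<union> snd ` set (qs @ [q]) \<times> {Minus}"
      by (rule subset_trans[OF f]) auto
    ultimately show ?thesis unfolding image_Un by (meson Un_least subset_trans)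
  qed
  have "linkage Z0 (qs @ [q]) (ps @ [p]) (Is @ [?I]) (F \<union> F') (insert w Z)"
    unfolding linkage_def using len Z lk used dj fs by (auto simp del: nth_append)
  moreover have "card (F \<union> F') + card (insert w Z) \<le> card Z0 + (2 * h + 1) * length (qs @ [q])"
    using c F'(3) card_Un_le[of F F'] card_insert_le_m1[of "Suc (card Z)" Z w] by simp
  ultimately show ?case using F'(1,2) by blast
qed

text \<open>
  The endpoints may lie in \<open>A\<close> as long as they are blocked by \<open>Z0\<close>; this covers the empty list of
  arcs, where any arc of \<open>D\<close> inside \<open>A\<close> is completed to a cycle.
\<close>

lemma cycle_through_arcs:
  assumes es: "es \<noteq> []" "distinct es"
    and disj: "pairwise (\<lambda>e f. disjnt {fst e, snd e} {fst f, snd f}) (set es)"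
    and ends: "\<And>e. e \<in> set es \<Longrightarrow> fst e \<noteq> snd e \<and> {fst e, snd e} \<subseteq> Y"
    and Y: "Y \<subseteq> pverts D - (A - Z0)"
    and Z0: "finite Z0" "card Z0 \<le> K"
    and b: "card Z0 + (2 * h + 1) * length es + 4 * K * m \<le> b" and h: "m \<le> K ^ h"
  shows "\<exists>u p. u \<in> Y \<and> pcas u p u \<and> p \<noteq> [] \<and> distinct (tl (pawalk_verts u p)) \<and> subseq es p \<and>
    set p \<subseteq> set es \<union> {e \<in> parcs D. fst e \<in> A \<union> Y \<and> snd e \<in> A \<union> Y}"
proof -
  let ?l = "length es"
  \<comment> \<open>For a single arc \<open>nxt 0 = 0\<close>: the link leads from the head of the
    arc back to its own tail.\<close>
  define nxt where "nxt i = Suc i mod ?l" for i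
  define qs where "qs = map (\<lambda>i. (snd (es ! i), fst (es ! nxt i))) [0..<?l]"
  have l: "?l > 0" using es(1) by simp
  have nxt: "nxt i < ?l" for i using l by (simp add: nxt_def)
  have inj_nxt: "i = j" if "nxt i = nxt j" "i < ?l" "j < ?l" for i j
    using that unfolding nxt_def by (auto simp: mod_Suc split: if_splits)
  have dj: "{fst (es ! i), snd (es ! i)} \<inter> {fst (es ! j), snd (es ! j)} = {}"
    if "i \<noteq> j" "i < ?l" "j < ?l" for i j
    using pairwiseD[OF disj, of "es ! i" "es ! j"] es(2) that
    by (auto simp: nth_eq_iff_index_eq disjnt_def)
  have ne: "fst (es ! i) \<noteq> snd (es ! i)" "fst (es ! i) \<in> Y" "snd (es ! i) \<in> Y" if "i < ?l" for i
    using ends[of "es ! i"] that by auto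
  have qi: "qs ! i = (snd (es ! i), fst (es ! nxt i))" if "i < ?l" for i
    using that by (simp add: qs_def)
  have lq: "length qs = ?l" by (simp add: qs_def)
  have "inj_on (\<lambda>i. snd (es ! i)) {0..<?l}"
    using dj by (intro inj_onI) (metis IntI atLeastLessThan_iff empty_iff insertCI)
  moreover have "inj_on (\<lambda>i. fst (es ! nxt i)) {0..<?l}"
    using dj nxt inj_nxt by (intro inj_onI) (metis IntI atLeastLessThan_iff empty_iff insertCI)
  ultimately have dq: "distinct (map fst qs)" "distinct (map snd qs)"
    unfolding qs_def by (simp_all add: distinct_map comp_def)
  have qY: "fst q \<in> pverts D - (A - Z0) \<and> snd q \<in> pverts D - (A - Z0)" if "q \<in> set qs" for q
  proof -
    have "fst q \<in> Y \<and> snd q \<in> Y" using that ne(2)[OF nxt] ne(3) unfolding qs_def by auto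
    then show ?thesis using Y by auto
  qed
  have "card Z0 + (2 * h + 1) * length qs + 4 * K * m \<le> b" using b unfolding lq .
  from connect_pairs[OF dq qY Z0 this h] obtain ps Is F Z where link: "linkage Z0 qs ps Is F Z"
    by blast
  have len: "length ps = ?l" using link unfolding linkage_def lq by simp
  have lk: "links Z0 (qs ! i) (ps ! i) (Is ! i)" if "i < ?l" for i
    using link that unfolding linkage_def lq by simp
  have dI: "Is ! i \<inter> Is ! j = {}" if "i < j" "j < ?l" for i j
    using link that unfolding linkage_def lq by simp
  let ?p = "concat (map2 (#) es ps)"
  \<comment> \<open>Taking the index modulo the length repeats the first tail at the end, which
    closes the chain.\<close>
  let ?us = "map (\<lambda>i. fst (es ! (i mod ?l))) [0..<Suc ?l]"
  have pc: "pcas (snd (es ! i)) (ps ! i) (fst (es ! nxt i))" "set (ps ! i) \<subseteq> parcs D"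
    "distinct (pawalk_verts (snd (es ! i)) (ps ! i))"
    "set (pawalk_verts (snd (es ! i)) (ps ! i)) \<subseteq> {snd (es ! i), fst (es ! nxt i)} \<union> Is ! i"
    "Is ! i \<subseteq> A - Z0" if "i < ?l" for i
    using lk[OF that] qi[OF that] unfolding links_def by auto
  have us_nth: "?us ! i = fst (es ! (i mod ?l))" if "i < Suc ?l" for i
    using that by (simp only: nth_map length_upt diff_zero nth_upt add_0)
  have cond: "fst (es ! i) = ?us ! i \<and> pcas (snd (es ! i)) (ps ! i) (?us ! Suc i)" if "i < ?l" for i
    using pc(1)[OF that] that us_nth[of i] us_nth[of "Suc i"] unfolding nxt_def by simp
  have us0: "?us ! 0 = fst (es ! 0)" using us_nth[of 0] by simp
  have usl: "last ?us = fst (es ! 0)" by simp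
  have walk: "pcas (fst (es ! 0)) ?p (fst (es ! 0))"
    "pawalk_verts (fst (es ! 0)) ?p = fst (es ! 0) # concat (map2 (\<lambda>e. pawalk_verts (snd e)) es ps)"
    using closed_walk_through_arcs[OF len _ cond] unfolding us0 usl by auto
  have "distinct (concat (map2 (\<lambda>e. pawalk_verts (snd e)) es ps))"
  proof (rule distinct_concat_map2I[OF len])
    show "distinct (pawalk_verts (snd (es ! i)) (ps ! i))" if "i < ?l" for i by (rule pc(3)[OF that])
  next
    fix i j assume ij: "i < j" "j < ?l"
    have "nxt i \<noteq> nxt j" using inj_nxt[of i j] ij by auto
    have sf: "snd (es ! i) \<noteq> fst (es ! k)" if "i < ?l" "k < ?l" for i k
      using dj[of i k] ne(1)[of k] that by (cases "i = k") auto
    have il: "i < ?l" using ij by simp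
    \<comment> \<open>Ends of different links are distinct because the arcs are disjoint. All ends
      avoid \<open>A - Z0\<close>, which contains the reserved interiors, and these are pairwise
      disjoint.\<close>
    let ?B = "\<lambda>i. {snd (es ! i), fst (es ! nxt i)}"
    have "snd (es ! i) \<noteq> snd (es ! j)" using dj[of i j] il ij by auto
    moreover have "fst (es ! nxt i) \<noteq> fst (es ! nxt j)"
      using dj[OF \<open>nxt i \<noteq> nxt j\<close> nxt nxt] by auto
    ultimately have BB: "?B i \<inter> ?B j = {}"
      using sf[OF il nxt, of j] sf[OF ij(2) nxt, of i] by auto
    have BA: "?B i \<inter> (A - Z0) = {}" if "i < ?l" for i
      using ne(2)[OF nxt, of i] ne(3)[OF that] Y by auto
    have "?B i \<inter> Is ! j = {}" using BA[OF il] pc(5)[OF ij(2)] by auto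
    moreover have "Is ! i \<inter> ?B j = {}" using BA[OF ij(2)] pc(5)[OF il] by auto
    ultimately have "(?B i \<union> Is ! i) \<inter> (?B j \<union> Is ! j) = {}"
      using BB dI[OF ij] by (simp only: Int_Un_distrib Int_Un_distrib2 Un_empty)
    then show "set (pawalk_verts (snd (es ! i)) (ps ! i)) \<inter>
        set (pawalk_verts (snd (es ! j)) (ps ! j)) = {}"
      using Int_mono[OF pc(4)[OF il] pc(4)[OF ij(2)]] by (simp only: subset_empty)
  qed
  then have "distinct (tl (pawalk_verts (fst (es ! 0)) ?p))" using walk(2) by simp
  moreover have "?p \<noteq> []" using es(1) len by (cases es; cases ps) auto
  moreover have "subseq es ?p" by (rule subseq_concat_map2_Cons[OF len])
  moreover have "set ?p \<subseteq> set es \<union> {e \<in> parcs D. fst e \<in> A \<union> Y \<and> snd e \<in> A \<union> Y}"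
  proof
    fix e assume "e \<in> set ?p"
    then obtain i where i: "i < ?l" "e = es ! i \<or> e \<in> set (ps ! i)"
      using len by (auto simp: set_zip)
    have "e \<in> {e \<in> parcs D. fst e \<in> A \<union> Y \<and> snd e \<in> A \<union> Y}" if "e \<in> set (ps ! i)"
    proof -
      have "{fst e, snd e} \<subseteq> {snd (es ! i), fst (es ! nxt i)} \<union> Is ! i"
        using pcas_arc_ends[OF pc(1)[OF i(1)] that] pc(4)[OF i(1)] by blast
      then show ?thesis using pc(2,5)[OF i(1)] that ne(2)[OF nxt] ne(3)[OF i(1)] by auto
    qed
    then show "e \<in> set es \<union> {e \<in> parcs D. fst e \<in> A \<union> Y \<and> snd e \<in> A \<union> Y}" using i by auto
  qed
  ultimately show ?thesis using walk(1) ne(2)[of 0] l by blast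
qed

text \<open>Disjoint arcs have distinct tails, so at most \<open>card V\<close> links are built. The
  second bound serves the empty list: one link and two blocked ends.\<close>

lemma strongly_connected:
  assumes V: "V \<subseteq> pverts D - A" and ne: "pverts D \<noteq> {}"
    and b: "(2 * h + 1) * card V + 4 * K * m \<le> b" "2 + (2 * h + 1) + 4 * K * m \<le> b"
    and h: "m \<le> K ^ h"
  shows "strongly_connected_in V (with_proj D \<restriction> (A \<union> V))"
proof -
  \<comment> \<open>These functions depend on \<open>G\<close> only through \<open>tail\<close> and
    \<open>head\<close>, so adding \<open>es\<close> to the arcs does not affect them.\<close>
  have cas: "pre_digraph.cas G u p v = pcas u p v"
    "pre_digraph.awalk_verts G u p = pawalk_verts u p" if "tail G = fst" "head G = snd"
    for G :: "('a, 'a \<times> 'a) pre_digraph" and u v p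
    using that by (induction p arbitrary: u)
      (auto simp: pre_digraph.cas.simps pre_digraph.awalk_verts.simps)
  have finV: "finite V" using V finite_pverts finite_subset by blast
  have "\<exists>p. pre_digraph.cycle ((with_proj D \<restriction> (A \<union> V))
      \<lparr>arcs := arcs (with_proj D \<restriction> (A \<union> V)) \<union> set es\<rparr>) p \<and> subseq es p"
    if es: "distinct es" "\<forall>(x, y)\<in>set es. x \<in> V \<and> y \<in> V \<and> x \<noteq> y"
      "pairwise (\<lambda>e f. disjnt {fst e, snd e} {fst f, snd f}) (set es)" for es
  proof -
    have "\<exists>u p. u \<in> A \<union> V \<and> pcas u p u \<and> p \<noteq> [] \<and> distinct (tl (pawalk_verts u p)) \<and> subseq es p \<and>
      set p \<subseteq> set es \<union> {e \<in> parcs D. fst e \<in> A \<union> V \<and> snd e \<in> A \<union> V}"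
    proof (cases "es = []")
      case True
      \<comment> \<open>Expansion of singletons gives every vertex an out-neighbour in
        \<open>A\<close>; using it twice yields an arc inside \<open>A\<close>.\<close>
      have nbr: "\<exists>a\<in>A. (v, a) \<in> parcs D" if "v \<in> pverts D" for v
      proof -
        have "4 * K * card {v} \<le> card (\<Union>u\<in>{v}. nbrs Plus D u \<inter> A)"
          using that m_ge by (intro small_sets) auto
        then have "nbrs Plus D v \<inter> A \<noteq> {}" using K_ge by auto
        then show ?thesis by auto
      qed
      then obtain a c where ac: "a \<in> A" "c \<in> A" "(a, c) \<in> parcs D"
        using ne A_sub by (meson ex_in_conv subsetD)
      have "a \<noteq> c" using digraph ac(3) pair_loopfree_digraph.pair_no_loops[of D "(a, c)"]
        by (auto simp: pair_digraph_def)
      then have c2: "card {a, c} = 2" by simp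
      \<comment> \<open>Blocking \<open>a\<close> and \<open>c\<close> takes them out of the pool
        for interiors. As \<open>(a, c)\<close> is an arc of \<open>D\<close>, the cycle contains no
        added arc.\<close>
      have "\<exists>u p. u \<in> {a, c} \<and> pcas u p u \<and> p \<noteq> [] \<and> distinct (tl (pawalk_verts u p)) \<and>
        subseq [(a, c)] p \<and>
        set p \<subseteq> set [(a, c)] \<union> {e \<in> parcs D. fst e \<in> A \<union> {a, c} \<and> snd e \<in> A \<union> {a, c}}"
        using \<open>a \<noteq> c\<close> ac A_sub K_ge b(2) c2
        by (intro cycle_through_arcs[OF _ _ _ _ _ _ _ _ h, where ?Z0.0 = "{a, c}"]) auto
      then obtain u p where "u \<in> {a, c}" "pcas u p u" "p \<noteq> []" "distinct (tl (pawalk_verts u p))"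
        "set p \<subseteq> set [(a, c)] \<union> {e \<in> parcs D. fst e \<in> A \<union> {a, c} \<and> snd e \<in> A \<union> {a, c}}"
        by blast
      then show ?thesis using ac True by (intro exI[of _ u] exI[of _ p]) auto
    next
      case False
      have "inj_on fst (set es)"
        using es(3) by (intro inj_onI) (auto simp: pairwise_def disjnt_def)
      moreover have "fst ` set es \<subseteq> V" using es(2) by auto
      ultimately have "length es \<le> card V"
        using card_inj_on_le[OF _ _ finV] distinct_card[OF es(1)] by metis
      then have "(2 * h + 1) * length es + 4 * K * m \<le> b"
        using b(1) mult_le_mono2[of "length es" "card V" "2 * h + 1"] by linarith
      then have "card {} + (2 * h + 1) * length es + 4 * K * m \<le> b" by simp
      moreover have "fst e \<noteq> snd e \<and> {fst e, snd e} \<subseteq> V" if "e \<in> set es" for e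
        using es(2) that by auto
      moreover have "V \<subseteq> pverts D - (A - {})" using V by simp
      ultimately have "\<exists>u p. u \<in> V \<and> pcas u p u \<and> p \<noteq> [] \<and> distinct (tl (pawalk_verts u p)) \<and>
          subseq es p \<and> set p \<subseteq> set es \<union> {e \<in> parcs D. fst e \<in> A \<union> V \<and> snd e \<in> A \<union> V}"
        by (intro cycle_through_arcs[OF False es(1,3) _ _ _ _ _ h, where ?Z0.0 = "{}"]) simp_all
      then obtain u p where "u \<in> V" "pcas u p u" "p \<noteq> []" "distinct (tl (pawalk_verts u p))"
        "subseq es p" "set p \<subseteq> set es \<union> {e \<in> parcs D. fst e \<in> A \<union> V \<and> snd e \<in> A \<union> V}"
        by blast
      then show ?thesis by (intro exI[of _ u] exI[of _ p]) simp
    qed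
    then obtain u p where up: "u \<in> A \<union> V" "pcas u p u" "p \<noteq> []" "distinct (tl (pawalk_verts u p))"
      "subseq es p" "set p \<subseteq> set es \<union> {e \<in> parcs D. fst e \<in> A \<union> V \<and> snd e \<in> A \<union> V}"
      by blast
    then show ?thesis
      by (intro exI[of _ p])
        (auto simp: pre_digraph.cycle_def pre_digraph.awalk_def cas intro!: exI[of _ u])
  qed
  then show ?thesis unfolding strongly_connected_in_def by auto
qed

end


section \<open>Parameters\<close>

text \<open>
  Condition (A3) only concerns disjoint sets, whereas the neighbourhood of \<open>U\<close> may meet \<open>U\<close>. A
  random \<open>Z \<subseteq> U\<close> separates them: with probability at least 1/4 a vertex lies in \<open>Z\<close> and keeps
  half of its neighbours outside \<open>Z\<close>, since replacing \<open>Z\<close> by its complement swaps the two parts.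
\<close>

lemma half_of_subsets_leave_half:
  fixes B :: "'a set"
  assumes U: "finite U" "v \<in> U" and B: "finite B" "v \<notin> B"
  shows "2 ^ card U \<le> 4 * card {Z \<in> Pow U. v \<in> Z \<and> card B \<le> 2 * card (B - Z)}"
proof -
  define W where "W = U - {v}"
  define S where "S = {Z \<in> Pow W. card B \<le> 2 * card (B - insert v Z)}"
  have finW: "finite W" using U by (simp add: W_def)
  have finS: "finite S" using finW by (simp add: S_def)
  \<comment> \<open>Complements are taken inside \<open>W\<close>, so that \<open>v\<close> can be
    inserted on both sides; since \<open>v \<notin> B\<close>, the two remainders still cover
    \<open>B\<close>.\<close>
  have "Pow W \<subseteq> S \<union> (\<lambda>Z. W - Z) ` S"
  proof
    fix Z assume Z: "Z \<in> Pow W"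
    have "B \<subseteq> (B - insert v Z) \<union> (B - insert v (W - Z))" using B(2) Z by auto
    then have "card B \<le> card ((B - insert v Z) \<union> (B - insert v (W - Z)))"
      using B(1) by (intro card_mono) auto
    also have "\<dots> \<le> card (B - insert v Z) + card (B - insert v (W - Z))" by (rule card_Un_le)
    finally have "Z \<in> S \<or> W - Z \<in> S" using Z unfolding S_def by auto
    moreover have "W - (W - Z) = Z" using Z by (simp add: double_diff)
    ultimately show "Z \<in> S \<union> (\<lambda>Z. W - Z) ` S" by (metis UnCI imageI)
  qed
  then have "card (Pow W) \<le> card (S \<union> (\<lambda>Z. W - Z) ` S)" using finS by (intro card_mono) auto
  also have "\<dots> \<le> card S + card ((\<lambda>Z. W - Z) ` S)" by (rule card_Un_le)
  also have "\<dots> \<le> card S + card S" by (simp add: card_image_le[OF finS])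
  finally have "2 ^ card W \<le> 2 * card S" using finW by (simp add: card_Pow)
  moreover have "card S \<le> card {Z \<in> Pow U. v \<in> Z \<and> card B \<le> 2 * card (B - Z)}"
  proof (rule card_inj_on_le[where f = "insert v"])
    have vS: "v \<notin> Z" if "Z \<in> S" for Z using that by (auto simp: S_def W_def)
    show "inj_on (insert v) S"
    proof (rule inj_onI)
      fix Y Z assume "Y \<in> S" "Z \<in> S" "insert v Y = insert v Z"
      then show "Y = Z" using vS[of Y] vS[of Z] insert_ident[of v Y Z] by simp
    qed
    show "insert v ` S \<subseteq> {Z \<in> Pow U. v \<in> Z \<and> card B \<le> 2 * card (B - Z)}"
    proof
      fix Y assume "Y \<in> insert v ` S"
      then obtain Z where Z: "Y = insert v Z" "Z \<subseteq> W" "card B \<le> 2 * card (B - insert v Z)"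
        by (auto simp: S_def)
      have "Y \<subseteq> U" using Z(1,2) U(2) unfolding W_def by blast
      then show "Y \<in> {Z \<in> Pow U. v \<in> Z \<and> card B \<le> 2 * card (B - Z)}"
        using Z(1,3) by simp
    qed
    have "finite (Pow U)" using U(1) by simp
    then show "finite {Z \<in> Pow U. v \<in> Z \<and> card B \<le> 2 * card (B - Z)}"
      by (rule rev_finite_subset[OF _ Collect_restrict])
  qed
  moreover have "card U = Suc (card W)" using card.remove[OF U] by (simp only: W_def)
  ultimately show ?thesis by simp
qed

text \<open>Averaging: each \<open>v\<close> succeeds for at least a quarter of the subsets of
  \<open>U\<close>, so double counting pairs \<open>(v, Z)\<close> gives a \<open>Z\<close> for
  which a quarter of \<open>U\<close> succeeds.\<close>

lemma exists_bipartition: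
  fixes B :: "'a \<Rightarrow> 'a set"
  assumes U: "finite U" and B: "\<And>v. v \<in> U \<Longrightarrow> finite (B v) \<and> v \<notin> B v"
  shows "\<exists>Z\<subseteq>U. card U \<le> 4 * card {v \<in> Z. card (B v) \<le> 2 * card (B v - Z)}"
proof (rule ccontr)
  define R where "R = (\<lambda>v Z. v \<in> Z \<and> card (B v) \<le> 2 * card (B v - Z))"
  assume "\<not> ?thesis"
  then have none: "\<not> card U \<le> 4 * card {v \<in> Z. card (B v) \<le> 2 * card (B v - Z)}" if "Z \<subseteq> U" for Z
    using that by simp
  have less: "4 * card {v \<in> U. R v Z} < card U" if "Z \<in> Pow U" for Z
  proof -
    have "{v \<in> U. R v Z} = {v \<in> Z. card (B v) \<le> 2 * card (B v - Z)}"
      using that unfolding R_def by auto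
    then show ?thesis using none that by (simp add: not_le)
  qed
  have "(\<Sum>v\<in>U. 2 ^ card U) \<le> (\<Sum>v\<in>U. 4 * card {Z \<in> Pow U. R v Z})"
    unfolding R_def using B U by (intro sum_mono half_of_subsets_leave_half) auto
  also have "\<dots> = 4 * (\<Sum>v\<in>U. \<Sum>Z | Z \<in> Pow U \<and> R v Z. 1)" by (simp add: sum_distrib_left)
  also have "(\<Sum>v\<in>U. \<Sum>Z | Z \<in> Pow U \<and> R v Z. 1) = (\<Sum>Z\<in>Pow U. \<Sum>v | v \<in> U \<and> R v Z. (1::nat))"
    using U by (intro sum.swap_restrict) auto
  also have "4 * \<dots> = (\<Sum>Z\<in>Pow U. 4 * card {v \<in> U. R v Z})" by (simp add: sum_distrib_left)
  also have "\<dots> < (\<Sum>Z\<in>Pow U. card U)" using U less by (intro sum_strict_mono) auto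
  finally show False using U by (simp add: card_Pow)
qed

text \<open>The hypothesis is applied to the successful vertices \<open>P\<close> of the split and
  the neighbours \<open>Q\<close> outside \<open>Z\<close>. Halved degrees cost the factor 2 in
  \<open>deg\<close>, and keeping a quarter of \<open>U\<close> costs the factor 4.\<close>

lemma expansion_from_disjoint_expansion:
  fixes N :: "'a \<Rightarrow> 'a set" and t g r :: real
  assumes exp: "\<And>P Q. P \<subseteq> X \<Longrightarrow> Q \<subseteq> X \<Longrightarrow> P \<inter> Q = {} \<Longrightarrow> real (card P) \<le> r \<Longrightarrow>
      (\<And>v. v \<in> P \<Longrightarrow> t \<le> real (card (N v \<inter> Q))) \<Longrightarrow> g * real (card P) \<le> real (card Q)"
    and U: "finite X" "U \<subseteq> X" "real (card U) \<le> r" and A: "A \<subseteq> X"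
    and deg: "\<And>v. v \<in> U \<Longrightarrow> 2 * t \<le> real (card (N v \<inter> A))"
    and loop: "\<And>v. v \<notin> N v" and g: "g \<ge> 0"
  shows "g * real (card U) \<le> 4 * real (card (\<Union>v\<in>U. N v \<inter> A))"
proof -
  have finU: "finite U" using U finite_subset by blast
  have "finite (N v \<inter> A) \<and> v \<notin> N v \<inter> A" for v using loop U(1) A finite_subset by blast
  then obtain Z where Z: "Z \<subseteq> U"
    "card U \<le> 4 * card {v \<in> Z. card (N v \<inter> A) \<le> 2 * card (N v \<inter> A - Z)}"
    using exists_bipartition[OF finU, of "\<lambda>v. N v \<inter> A"] by auto
  define P where "P = {v \<in> Z. card (N v \<inter> A) \<le> 2 * card (N v \<inter> A - Z)}"
  define Q where "Q = (\<Union>v\<in>U. N v \<inter> A) - Z"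
  have PU: "P \<subseteq> U" using Z(1) by (auto simp: P_def)
  have QX: "Q \<subseteq> X" using A by (auto simp: Q_def)
  have finQ: "finite Q" using QX U(1) finite_subset by blast
  have finA: "finite (\<Union>v\<in>U. N v \<inter> A)" by (rule finite_subset[OF _ U(1)]) (use A in auto)
  have "g * real (card P) \<le> real (card Q)"
  proof (rule exp[OF _ QX])
    show "P \<subseteq> X" using PU U by auto
    show "P \<inter> Q = {}" by (auto simp: P_def Q_def)
    show "real (card P) \<le> r" using card_mono[OF finU PU] U(3) by linarith
    fix v assume v: "v \<in> P"
    have "2 * t \<le> real (card (N v \<inter> A))" using deg v PU by auto
    also have "\<dots> \<le> 2 * real (card (N v \<inter> A - Z))" using v unfolding P_def by simp
    also have "card (N v \<inter> A - Z) \<le> card (N v \<inter> Q)"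
      using v PU finQ by (intro card_mono) (auto simp: Q_def)
    finally show "t \<le> real (card (N v \<inter> Q))" by simp
  qed
  also have "card Q \<le> card (\<Union>v\<in>U. N v \<inter> A)" using finA by (intro card_mono) (auto simp: Q_def)
  finally have "4 * (g * real (card P)) \<le> 4 * real (card (\<Union>v\<in>U. N v \<inter> A))" by simp
  moreover have "real (card U) \<le> 4 * real (card P)" using Z(2) unfolding P_def by linarith
  then have "g * real (card U) \<le> g * (4 * real (card P))" using g by (rule mult_left_mono)
  ultimately show ?thesis by simp
qed

section \<open>Inequalities between iterated logarithms for large \<open>n\<close>\<close>

lemma iter_log_simps:
  "iter_log 2 x = ln (ln x)" "iter_log 3 x = ln (ln (ln x))"
  by (simp_all add: iter_log_def numeral_eq_Suc)

lemma filterlim_iter_log: "filterlim (\<lambda>n. iter_log k (real n)) at_top sequentially"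
proof (induction k)
  case 0
  show ?case by (simp add: iter_log_def filterlim_real_sequentially)
next
  case (Suc k)
  show ?case using filterlim_compose[OF ln_at_top Suc] by (simp add: iter_log_def)
qed

text \<open>\<open>36 / \<epsilon>\<close> comes from requiring
  \<open>9 / iter_log 7 n \<le> \<epsilon> / 4\<close> in the cost of the links. The last two
  inequalities bound the cost of the trees and of one extra link by a quarter of the
  overlap.\<close>

lemma eventually_parameters:
  fixes \<epsilon> :: real
  assumes "\<epsilon> > 0"
  shows "\<forall>\<^sub>F n in sequentially.
    n \<ge> 1 \<and> ln (real n) \<ge> 1 \<and> iter_log 2 (real n) \<ge> 1 \<and> iter_log 3 (real n) \<ge> 1 \<and>
    iter_log 7 (real n) \<ge> 36 / \<epsilon> \<and>
    ln (real n) powr (1 / 3) \<ge> 32 \<and>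
    ln (real n) powr (1 / 4) + 1 \<le> ln (real n) powr (1 / 3) / 16 \<and>
    2 * ln (real n) powr (2 / 3) \<le> ln (real n) powr (3 / 4) \<and>
    10 ^ 5 * iter_log 3 (real n) \<le> ln (real n) \<and>
    3 * iter_log 2 (real n) \<le> ln (real n) \<and>
    10 ^ 5 * iter_log 3 (real n) ^ 2 * ln (real n) powr (1 / 3) / ln (real n) < \<epsilon> / 4 \<and>
    11 * ln (real n) * iter_log 3 (real n) / real n < \<epsilon> / 4"
proof -
  have e: "\<epsilon> / 4 > 0" using assms by simp
  have "((\<lambda>n. 10 ^ 5 * ln (ln (ln (real n))) ^ 2 * ln (real n) powr (1 / 3) / ln (real n)) \<longlongrightarrow> 0) sequentially"
    by real_asymp
  then have 1: "\<forall>\<^sub>F n in sequentially.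
      10 ^ 5 * ln (ln (ln (real n))) ^ 2 * ln (real n) powr (1 / 3) / ln (real n) < \<epsilon> / 4"
    using e by (rule order_tendstoD)
  have "((\<lambda>n. 11 * ln (real n) * ln (ln (ln (real n))) / real n) \<longlongrightarrow> 0) sequentially"
    by real_asymp
  then have 2: "\<forall>\<^sub>F n in sequentially. 11 * ln (real n) * ln (ln (ln (real n))) / real n < \<epsilon> / 4"
    using e by (rule order_tendstoD)
  have 3: "\<forall>\<^sub>F n in sequentially. iter_log 7 (real n) \<ge> 36 / \<epsilon>"
    using filterlim_iter_log[of 7] by (simp add: filterlim_at_top)
  have 4: "\<forall>\<^sub>F n in sequentially. n \<ge> 1" by (rule eventually_ge_at_top)
  have 5: "\<forall>\<^sub>F n in sequentially. ln (real n) \<ge> 1" by real_asymp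
  have 6: "\<forall>\<^sub>F n in sequentially. ln (ln (real n)) \<ge> 1" by real_asymp
  have 7: "\<forall>\<^sub>F n in sequentially. ln (ln (ln (real n))) \<ge> 1" by real_asymp
  have 8: "\<forall>\<^sub>F n in sequentially. ln (real n) powr (1 / 3) \<ge> 32" by real_asymp
  have 9: "\<forall>\<^sub>F n in sequentially. ln (real n) powr (1 / 4) + 1 \<le> ln (real n) powr (1 / 3) / 16"
    by real_asymp
  have 10: "\<forall>\<^sub>F n in sequentially. 2 * ln (real n) powr (2 / 3) \<le> ln (real n) powr (3 / 4)"
    by real_asymp
  have 11: "\<forall>\<^sub>F n in sequentially. 10 ^ 5 * ln (ln (ln (real n))) \<le> ln (real n)" by real_asymp
  have 12: "\<forall>\<^sub>F n in sequentially. 3 * ln (ln (real n)) \<le> ln (real n)" by real_asymp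
  show ?thesis
    unfolding iter_log_simps
    using 1 2 3 4 5 6 7 8 9 10 11 12 by (simp only: eventually_conj_iff)
qed

section \<open>Pseudorandom digraphs satisfy the expansion hypotheses\<close>

lemma pseudorandomD:
  assumes "pseudorandom d \<epsilon> D" "card (pverts D) = n"
  shows "\<And>s v. v \<in> pverts D \<Longrightarrow> d * ln (real n) \<le> real (deg_in_set s D v (pverts D))"
    and "\<And>s P Q. P \<subseteq> pverts D \<Longrightarrow> Q \<subseteq> pverts D \<Longrightarrow> P \<inter> Q = {} \<Longrightarrow>
      real (card P) \<le> 2 * m_par d n \<Longrightarrow>
      (\<And>v. v \<in> P \<Longrightarrow> d * ln (real n) powr (2 / 3) \<le> real (card (nbrs s D v \<inter> Q))) \<Longrightarrow>
      ln (real n) powr (1 / 3) * real (card P) \<le> real (card Q)"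
proof -
  note conj = assms(1)[unfolded pseudorandom_def Let_def assms(2)]
  show "d * ln (real n) \<le> real (deg_in_set s D v (pverts D))" if "v \<in> pverts D" for s v
    using conj[THEN conjunct1] that by simp
  show "ln (real n) powr (1 / 3) * real (card P) \<le> real (card Q)"
    if "P \<subseteq> pverts D" "Q \<subseteq> pverts D" "P \<inter> Q = {}" "real (card P) \<le> 2 * m_par d n"
      "\<And>v. v \<in> P \<Longrightarrow> d * ln (real n) powr (2 / 3) \<le> real (card (nbrs s D v \<inter> Q))" for s P Q
    by (rule conj[THEN conjunct2, THEN conjunct2, THEN conjunct1, rule_format, of P Q s])
      (use that in \<open>simp add: deg_in_set_def\<close>)
qed

text \<open>An out- and an in-neighbourhood of sets of size \<open>m\<close> overlap in at least
  \<open>\<epsilon> * card A\<close> vertices of \<open>A\<close>; the parameters are chosen so that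
  all costs together stay below this.\<close>

lemma strongly_connected_of_parameters:
  fixes \<epsilon> d :: real and D :: "'a pair_pre_digraph"
  assumes eps: "\<epsilon> > 0" and d: "d \<ge> 1 / 10 ^ 5" and n: "n \<ge> 1"
    and L1: "ln (real n) \<ge> 1" and l2: "iter_log 2 (real n) \<ge> 1" and l3: "iter_log 3 (real n) \<ge> 1"
    and l7: "iter_log 7 (real n) \<ge> 36 / \<epsilon>"
    and n1: "ln (real n) powr (1 / 3) \<ge> 32"
    and n2: "ln (real n) powr (1 / 4) + 1 \<le> ln (real n) powr (1 / 3) / 16"
    and n3: "2 * ln (real n) powr (2 / 3) \<le> ln (real n) powr (3 / 4)"
    and n4: "10 ^ 5 * iter_log 3 (real n) \<le> ln (real n)"
    and n5: "3 * iter_log 2 (real n) \<le> ln (real n)"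
    and n6: "10 ^ 5 * iter_log 3 (real n) ^ 2 * ln (real n) powr (1 / 3) / ln (real n) < \<epsilon> / 4"
    and n7: "11 * ln (real n) * iter_log 3 (real n) / real n < \<epsilon> / 4"
    and D: "pair_digraph D" "card (pverts D) = n" "pseudorandom d \<epsilon> D"
    and A: "A \<subseteq> pverts D" "real (card A) \<ge> real n / iter_log 3 (real n)"
    and deg: "\<And>s v. v \<in> pverts D \<Longrightarrow> real (deg_in_set s D v A) \<ge> d * ln (real n) powr (3 / 4)"
    and nbhd: "\<And>s U. U \<subseteq> pverts D \<Longrightarrow> card U = m_size d n \<Longrightarrow>
       real (card (ext_nbhd s D U \<inter> A)) \<ge> (1 / 2 + \<epsilon> / 2) * real (card A)"
    and V: "V \<subseteq> pverts D - A"
      "real (card V) \<le> real (card A) * iter_log 2 (real n) / (ln (real n) * iter_log 7 (real n))"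
  shows "strongly_connected_in V (with_proj D \<restriction> (A \<union> V))"
proof -
  define L l2 l3 l7 where "L = ln (real n)" and "l2 = iter_log 2 (real n)"
    and "l3 = iter_log 3 (real n)" and "l7 = iter_log 7 (real n)"
  note defs = L_def[symmetric] l2_def[symmetric] l3_def[symmetric] l7_def[symmetric]
  define a where "a = real (card A)"
  define m where "m = m_size d n"
  \<comment> \<open>\<open>16 = 4 * 4\<close>: one factor from
    \<open>expansion_from_disjoint_expansion\<close>, the other from
    \<open>small_sets\<close>.\<close>
  define K where "K = nat \<lfloor>L powr (1 / 3) / 16\<rfloor>"
  \<comment> \<open>As \<open>K \<ge> L powr (1 / 4) = exp (l2 / 4)\<close>, this depth gives
    \<open>K ^ h \<ge> exp L = n \<ge> m\<close>.\<close>
  define h where "h = nat \<lceil>4 * L / l2\<rceil>"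
  \<comment> \<open>In order: two trees, the links for \<open>V\<close>, the single link with two
    blocked ends for the empty list, and the requirement \<open>K \<le> b\<close>.\<close>
  define b where "b = 4 * K * m + (2 * h + 1) * card V + (2 * h + 1) + 2 + K"
  have pos: "L > 0" "l2 > 0" "l3 > 0" "l7 > 0" "real n > 0" "d > 0"
    using L1 l2 l3 l7 n d eps unfolding defs by (auto intro: less_le_trans[of 0 "36 / \<epsilon>"])
  have finX: "finite (pverts D)" using D(2) n card_gt_0_iff[of "pverts D"] by auto
  have finA: "finite A" using A(1) finX finite_subset by blast
  have a_ge: "real n / l3 \<le> a" using A(2) unfolding defs a_def .
  then have a_pos: "a > 0" using pos by (auto intro: less_le_trans[of 0 "real n / l3"])

  \<comment> \<open>Degrees are at most \<open>n\<close>; this makes \<open>m_par d n\<close> at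
    least 1, so rounding down leaves \<open>m \<ge> 1\<close>.\<close>
  have dL: "d * L \<le> real n"
  proof -
    obtain v where v: "v \<in> pverts D" using D(2) n by fastforce
    have "d * L \<le> real (deg_in_set Plus D v (pverts D))"
      using pseudorandomD(1)[OF D(3,2) v] unfolding defs .
    also have "deg_in_set Plus D v (pverts D) \<le> card (pverts D)"
      unfolding deg_in_set_def using finX by (intro card_mono) auto
    finally show ?thesis using D(2) by simp
  qed
  have mp: "m_par d n = real n * l3 / (d * L)" unfolding m_par_def defs by simp
  have "d * L * 1 \<le> real n * l3" using dL l3 pos unfolding defs by (intro mult_mono) auto
  then have mp1: "m_par d n \<ge> 1" unfolding mp using pos by (simp add: le_divide_eq)
  have m1: "m \<ge> 1" unfolding m_def m_size_def using mp1 by (simp add: le_nat_iff le_floor_iff)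
  have m_le: "real m \<le> m_par d n" unfolding m_def m_size_def using mp1 by simp
  have "real n * l3 / (d * L) \<le> real n * l3 / (1 / 10 ^ 5 * L)"
    using pos d by (intro divide_left_mono mult_right_mono) auto
  then have m_le': "real m \<le> 10 ^ 5 * real n * l3 / L" using m_le unfolding mp by (simp add: mult_ac)
  have m_le_n: "real m \<le> real n"
  proof -
    have "real n * (10 ^ 5 * l3) \<le> real n * L" using n4 pos unfolding defs by (intro mult_left_mono) auto
    then have "10 ^ 5 * real n * l3 / L \<le> real n" using pos by (simp add: divide_le_eq algebra_simps)
    then show ?thesis using m_le' by linarith
  qed

  have K_le: "real K \<le> L powr (1 / 3) / 16" unfolding K_def by (rule of_nat_floor) simp
  have K_gt: "real K \<ge> L powr (1 / 4)"
    using n2 unfolding defs K_def by linarith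
  have K2: "K \<ge> 2" unfolding K_def using n1 unfolding defs by (simp add: le_nat_iff le_floor_iff)
  have mKh: "m \<le> K ^ h"
  proof -
    have l2L: "l2 = ln L" unfolding l2_def L_def iter_log_simps by simp
    have "L powr (1 / 4) = exp (l2 / 4)" using pos unfolding l2L powr_def by simp
    then have K': "real K \<ge> exp (l2 / 4)" using K_gt by simp
    have "real h \<ge> 4 * L / l2" unfolding h_def by linarith
    then have "real h * (l2 / 4) \<ge> L" using pos by (simp add: divide_le_eq)
    then have "exp L \<le> exp (real h * (l2 / 4))" by simp
    also have "\<dots> = exp (l2 / 4) ^ h" by (rule exp_of_nat_mult)
    also have "\<dots> \<le> real K ^ h" using K' by (intro power_mono) auto
    finally have "real n \<le> real K ^ h" using pos unfolding L_def by simp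
    then have "real m \<le> real (K ^ h)" using m_le_n by simp
    then show ?thesis by (simp only: of_nat_le_iff)
  qed
  \<comment> \<open>Rounding up and the added 1 turn \<open>8 * L / l2\<close> into at most
    \<open>8 * L / l2 + 3\<close>, and \<open>3 \<le> L / l2\<close>.\<close>
  have h_le: "real (2 * h + 1) \<le> 9 * L / l2"
  proof -
    have "4 * L / l2 \<ge> 0" using pos by simp
    then have "real h \<le> 4 * L / l2 + 1" unfolding h_def by linarith
    moreover have "3 \<le> L / l2" using n5 pos unfolding defs by (simp add: le_divide_eq)
    moreover have "4 * L / l2 = 4 * (L / l2)" "9 * L / l2 = 9 * (L / l2)" by simp_all
    ultimately show ?thesis by linarith
  qed

  \<comment> \<open>\<open>9 = 4 + 4 + 1\<close>: the trees counted beside \<open>b\<close>, the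
    trees inside \<open>b\<close>, and \<open>K \<le> K * m\<close>.\<close>
  have X1: "9 * real K * real m < \<epsilon> / 4 * a"
  proof -
    have "9 * real K * real m \<le> 9 * (L powr (1 / 3) / 16) * (10 ^ 5 * real n * l3 / L)"
      using K_le m_le' pos by (intro mult_mono) auto
    \<comment> \<open>The constant is raised to 16 only to cancel the denominator.\<close>
    also have "\<dots> \<le> 16 * (L powr (1 / 3) / 16) * (10 ^ 5 * real n * l3 / L)"
      using pos by (intro mult_right_mono) auto
    also have "\<dots> = (10 ^ 5 * l3 ^ 2 * L powr (1 / 3) / L) * (real n / l3)"
      using pos by (simp add: field_simps power2_eq_square)
    also have "\<dots> < \<epsilon> / 4 * (real n / l3)"
      using n6 pos unfolding defs by (intro mult_strict_right_mono) auto
    also have "\<dots> \<le> \<epsilon> / 4 * a" using a_ge eps by (intro mult_left_mono) auto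
    finally show ?thesis .
  qed
  have X2: "real (2 * h + 1) * real (card V) \<le> \<epsilon> / 4 * a"
  proof -
    have "real (2 * h + 1) * real (card V) \<le> (9 * L / l2) * (a * l2 / (L * l7))"
      using h_le V(2) pos unfolding defs a_def[symmetric] by (intro mult_mono) auto
    also have "\<dots> = 9 / l7 * a" using pos by (simp add: field_simps)
    also have "\<dots> \<le> \<epsilon> / 4 * a"
      using l7 a_pos eps pos unfolding defs by (intro mult_right_mono) (auto simp: field_simps)
    finally show ?thesis .
  qed
  have X3: "real (2 * h + 1) + 2 < \<epsilon> / 4 * a"
  proof -
    have "L / l2 \<le> L / 1" using l2 pos unfolding defs by (intro divide_left_mono) auto
    then have "real (2 * h + 1) + 2 \<le> 11 * L" using h_le L1 unfolding defs by simp
    also have "\<dots> = (11 * L * l3 / real n) * (real n / l3)" using pos by simp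
    also have "\<dots> < \<epsilon> / 4 * (real n / l3)"
      using n7 pos unfolding defs by (intro mult_strict_right_mono) auto
    also have "\<dots> \<le> \<epsilon> / 4 * a" using a_ge eps by (intro mult_left_mono) auto
    finally show ?thesis .
  qed
  have budget: "real (4 * K * m + b) < \<epsilon> * a"
  proof -
    have "real K * 1 \<le> real K * real m" using m1 by (intro mult_left_mono) auto
    moreover have "real (4 * K * m + b) =
        8 * (real K * real m) + real (2 * h + 1) * real (card V) + (real (2 * h + 1) + 2) + real K"
      unfolding b_def by (simp add: algebra_simps)
    moreover have "9 * (real K * real m) < \<epsilon> / 4 * a" using X1 by (simp add: mult.assoc)
    ultimately have "real (4 * K * m + b) < 3 * (\<epsilon> / 4 * a)" using X2 X3 by linarith
    also have "\<dots> \<le> \<epsilon> * a" using eps a_pos by simp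
    finally show ?thesis .
  qed

  define N where "N s U = (\<Union>u\<in>U. nbrs s D u \<inter> A)" for s U
  have finN: "finite (N s U)" "N s U \<subseteq> A" for s U
    using finite_subset[OF _ finA] unfolding N_def by auto
  have N_ge: "(1 / 2 + \<epsilon> / 2) * a \<le> real (card (N s U))" if "U \<subseteq> pverts D" "card U = m" for s U
  proof -
    have "(1 / 2 + \<epsilon> / 2) * a \<le> real (card (ext_nbhd s D U \<inter> A))"
      using nbhd[of U s] that unfolding a_def m_def by blast
    also have "card (ext_nbhd s D U \<inter> A) \<le> card (N s U)"
      using finN by (intro card_mono) (auto simp: ext_nbhd_def N_def)
    finally show ?thesis by simp
  qed
  have small: "4 * K * card U \<le> card (N s U)" if U: "U \<subseteq> pverts D" "card U \<le> m" for s U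
  proof -
    have "L powr (1 / 3) * real (card U) \<le> 4 * real (card (\<Union>v\<in>U. nbrs s D v \<inter> A))"
    proof (rule expansion_from_disjoint_expansion[where X = "pverts D"])
      show "L powr (1 / 3) * real (card P) \<le> real (card Q)"
        if "P \<subseteq> pverts D" "Q \<subseteq> pverts D" "P \<inter> Q = {}" "real (card P) \<le> 2 * m_par d n"
          "\<And>v. v \<in> P \<Longrightarrow> d * L powr (2 / 3) \<le> real (card (nbrs s D v \<inter> Q))" for P Q
        using pseudorandomD(2)[OF D(3,2) that(1-4), of s] that(5) unfolding defs by blast
      show "real (card U) \<le> 2 * m_par d n" using U(2) m_le mp1 by linarith
      \<comment> \<open>The degree into \<open>A\<close> is of order \<open>L powr (3 / 4)\<close>,
        so it exceeds twice the threshold of (A3).\<close>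
      show "2 * (d * L powr (2 / 3)) \<le> real (card (nbrs s D v \<inter> A))" if v: "v \<in> U" for v
      proof -
        have "d * (2 * L powr (2 / 3)) \<le> d * L powr (3 / 4)"
          using n3 pos unfolding defs by (intro mult_left_mono) auto
        also have "\<dots> \<le> real (deg_in_set s D v A)" using deg v U(1) unfolding defs by blast
        finally show ?thesis by (simp add: deg_in_set_def)
      qed
      show "v \<notin> nbrs s D v" for v
        using D(1) pair_loopfree_digraph.pair_no_loops[of D "(v, v)"]
        by (cases s) (auto simp: pair_digraph_def)
    qed (use finX U(1) A(1) in auto)
    moreover have "16 * real K * real (card U) \<le> L powr (1 / 3) * real (card U)"
      using K_le by (intro mult_right_mono) auto
    ultimately have "16 * real K * real (card U) \<le> 4 * real (card (N s U))" unfolding N_def by linarith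
    then have "real (4 * K * card U) \<le> real (card (N s U))" by simp
    then show ?thesis by (simp only: of_nat_le_iff)
  qed
  have large: "4 * K * m + b < card (N s U)" if "U \<subseteq> pverts D" "card U = m" for s U
  proof -
    \<comment> \<open>The neighbourhood fits into \<open>A\<close>, which forces
      \<open>\<epsilon> \<le> 1\<close>; hence \<open>\<epsilon> * a\<close> is at most the
      guaranteed size.\<close>
    have "card (N s U) \<le> card A" using finN finA by (intro card_mono) auto
    then have "(1 / 2 + \<epsilon> / 2) * a \<le> 1 * a" using N_ge[OF that, of s] unfolding a_def by linarith
    then have "\<epsilon> \<le> 1" using a_pos by (simp only: mult_le_cancel_right_pos)
    then have "\<epsilon> * a \<le> (1 / 2 + \<epsilon> / 2) * a" using a_pos by (intro mult_right_mono) auto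
    then have "real (4 * K * m + b) < real (card (N s U))" using budget N_ge[OF that, of s] by linarith
    then show ?thesis by (simp only: of_nat_less_iff)
  qed
  have meet: "2 * K * m + b < card (N Plus U \<inter> N Minus W)"
    if U: "U \<subseteq> pverts D" "card U = m" and W: "W \<subseteq> pverts D" "card W = m" for U W
  proof -
    \<comment> \<open>Inclusion-exclusion inside \<open>A\<close>: two parts of proportion
      \<open>1 / 2 + \<epsilon> / 2\<close> overlap in proportion at least
      \<open>\<epsilon>\<close>.\<close>
    have "card (N Plus U) + card (N Minus W) = card (N Plus U \<union> N Minus W) + card (N Plus U \<inter> N Minus W)"
      using finN by (intro card_Un_Int) auto
    moreover have "card (N Plus U \<union> N Minus W) \<le> card A" using finN finA by (intro card_mono) auto
    ultimately have "real (card (N Plus U)) + real (card (N Minus W)) \<le> a + real (card (N Plus U \<inter> N Minus W))"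
      unfolding a_def by linarith
    moreover have "(1 / 2 + \<epsilon> / 2) * a + (1 / 2 + \<epsilon> / 2) * a = a + \<epsilon> * a" by (simp add: algebra_simps)
    ultimately have "\<epsilon> * a \<le> real (card (N Plus U \<inter> N Minus W))"
      using N_ge[OF U, of Plus] N_ge[OF W, of Minus] by linarith
    then have "real (4 * K * m + b) < real (card (N Plus U \<inter> N Minus W))" using budget by linarith
    then have "4 * K * m + b < card (N Plus U \<inter> N Minus W)" by (simp only: of_nat_less_iff)
    then show ?thesis by linarith
  qed
  have "K \<le> b" by (simp add: b_def)
  interpret digraph_expansion D A K m b
    by (rule digraph_expansion.intro[OF D(1) A(1) K2 m1 \<open>K \<le> b\<close> small[unfolded N_def]
      large[unfolded N_def] meet[unfolded N_def]])
  show ?thesis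
  proof (rule strongly_connected[OF V(1) _ _ _ mKh])
    show "pverts D \<noteq> {}" using D(2) n by auto
    show "(2 * h + 1) * card V + 4 * K * m \<le> b" "2 + (2 * h + 1) + 4 * K * m \<le> b"
      by (simp_all add: b_def)
  qed
qed

theorem theorem4p7:
  fixes \<epsilon> :: real
  assumes "\<epsilon> > 0"
  shows "\<exists>n0::nat. \<forall>(d::real) (n::nat) (D :: 'a pair_pre_digraph) (A :: 'a set).
    d \<ge> 1 / 10 ^ 5 \<and> n \<ge> n0 \<and>
    pair_digraph D \<and> card (pverts D) = n \<and> pseudorandom d \<epsilon> D \<and>
    A \<subseteq> pverts D \<and> real (card A) \<ge> real n / iter_log 3 (real n) \<and>
    (\<forall>s. \<forall>v\<in>pverts D. real (deg_in_set s D v A) \<ge> d * ln (real n) powr (3 / 4)) \<and>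
    (\<forall>s U. U \<subseteq> pverts D \<and> card U = m_size d n \<longrightarrow>
       real (card (ext_nbhd s D U \<inter> A)) \<ge> (1 / 2 + \<epsilon> / 2) * real (card A))
    \<longrightarrow> (\<forall>V. V \<subseteq> pverts D - A \<and>
          real (card V) \<le> real (card A) * iter_log 2 (real n) / (ln (real n) * iter_log 7 (real n))
          \<longrightarrow> strongly_connected_in V (with_proj D \<restriction> (A \<union> V)))"
proof -
  obtain n0 where n0: "\<And>n. n \<ge> n0 \<Longrightarrow>
      n \<ge> 1 \<and> ln (real n) \<ge> 1 \<and> iter_log 2 (real n) \<ge> 1 \<and> iter_log 3 (real n) \<ge> 1 \<and>
      iter_log 7 (real n) \<ge> 36 / \<epsilon> \<and>
      ln (real n) powr (1 / 3) \<ge> 32 \<and>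
      ln (real n) powr (1 / 4) + 1 \<le> ln (real n) powr (1 / 3) / 16 \<and>
      2 * ln (real n) powr (2 / 3) \<le> ln (real n) powr (3 / 4) \<and>
      10 ^ 5 * iter_log 3 (real n) \<le> ln (real n) \<and>
      3 * iter_log 2 (real n) \<le> ln (real n) \<and>
      10 ^ 5 * iter_log 3 (real n) ^ 2 * ln (real n) powr (1 / 3) / ln (real n) < \<epsilon> / 4 \<and>
      11 * ln (real n) * iter_log 3 (real n) / real n < \<epsilon> / 4"
    using eventually_parameters[OF assms] unfolding eventually_sequentially by blast
  show ?thesis
    by (intro exI[of _ n0] allI impI, elim conjE)
      (rule strongly_connected_of_parameters[OF assms], use n0 in auto)
qed

end
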